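(* Let $H\in\mathfrak t$ be a mass linear function on a simple polytope $\Delta\subset\mathfrak t^*$. Then every asymmetric facet of $\Delta$ is pervasive or flat (or both).
   Context: Let $\mathfrak t$ be a finite-dimensional real vector space with dual $\mathfrak t^*$ and pairing $\langle\cdot,\cdot\rangle$. A polytope is a bounded set $\Delta=\bigcap_{i=1}^N\{x\in\mathfrak t^*\mid\langle\eta_i,x\rangle\le\kappa_i\}$ with outward conormals $\eta_i\in\mathfrak t$ and support numbers $\kappa_i\in\mathbb R$, where $\Delta$ affinely spans $\mathfrak t^*$ and each facet $F_i=\Delta\cap\{\langle\eta_i,x\rangle=\kappa_i\}$ affinely spans a hyperplane. It is simple if exactly $\dim\mathfrak t$ facets meet at each vertex. For $\kappa'\in\mathbb R^N$ let $\Delta(\kappa')=\bigcap_i\{\langle\eta_i,x\rangle\le\kappa'_i\}$. The chamber $\mathcal C_\Delta\subset\mathbb R^N$ is the connected component containing $\kappa$ of the set of $\kappa'$ for which $\Delta(\kappa')$ is a simple polytope (with $N$ facets, that is, $\Delta(\kappa')$ affinely spans $\mathfrak t^*$, each of the $N$ sets $\Delta(\kappa')\cap\{\langle\eta_i,x\rangle=\kappa'_i\}$ affinely spans a hyperplane, and exactly $\dim\mathfrak t$ of these $N$ facets meet at each vertex). $c_\Delta(\kappa')$ is the center of mass of $\Delta(\kappa')$. $H\in\mathfrak t$ is mass linear on $\Delta$ if $\langle H,c_\Delta(\kappa')\rangle=\sum_i\gamma_i\kappa'_i+C$ on $\mathcal C_\Delta$ for some real constants $\gamma_i,C$. A facet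 $F_i$ is symmetric (with respect to $H$) if $\kappa'\mapsto\langle H,c_\Delta(\kappa')\rangle$ on $\mathcal C_\Delta$ does not depend on $\kappa'_i$, and asymmetric otherwise. A facet $F$ is pervasive if it has nonempty intersection with every other facet of $\Delta$. A facet $F$ is flat if there is a hyperplane (linear, of codimension one) in $\mathfrak t$ containing the conormal of every facet, other than $F$ itself, that meets $F$. *)

theory Defs
  imports "HOL-Analysis.Analysis"
begin

text \<open>
  The dual of \<open>\<tt>\<close> is identified with \<open>\<tt>\<close> by an inner product, so a single type
  \<open>'a :: euclidean_space\<close> serves for both and the pairing is \<open>\<bullet>\<close>. The notions below are affine
  invariants of the dual space (the center of mass does not depend on how the translation-invariant
  measure is normalised), so the choice of inner product is immaterial. The index type \<open>'n\<close> stands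
  for \<open>{1..N}\<close>, and support numbers are vectors in \<open>real ^ 'n\<close>.
\<close>

definition Delta :: "('n::finite \<Rightarrow> 'a::euclidean_space) \<Rightarrow> real ^ 'n \<Rightarrow> 'a set" where
  "Delta \<eta> \<kappa> = (\<Inter>i. {x. \<eta> i \<bullet> x \<le> \<kappa> $ i})"

definition facet :: "('n::finite \<Rightarrow> 'a::euclidean_space) \<Rightarrow> real ^ 'n \<Rightarrow> 'n \<Rightarrow> 'a set" where
  "facet \<eta> \<kappa> i = Delta \<eta> \<kappa> \<inter> {x. \<eta> i \<bullet> x = \<kappa> $ i}"

definition is_polytope :: "('n::finite \<Rightarrow> 'a::euclidean_space) \<Rightarrow> real ^ 'n \<Rightarrow> bool" where
  "is_polytope \<eta> \<kappa> \<longleftrightarrow>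
     bounded (Delta \<eta> \<kappa>) \<and>
     affine hull (Delta \<eta> \<kappa>) = UNIV \<and>
     (\<forall>i. \<exists>a b. a \<noteq> 0 \<and> affine hull (facet \<eta> \<kappa> i) = {x. a \<bullet> x = b})"

text \<open>
  Facets at a vertex are counted by index. This also rules out listing the same facet twice: a
  repeated facet would have a vertex, where fewer than \<open>DIM('a)\<close> distinct hyperplanes would meet.
\<close>

definition simple_polytope :: "('n::finite \<Rightarrow> 'a::euclidean_space) \<Rightarrow> real ^ 'n \<Rightarrow> bool" where
  "simple_polytope \<eta> \<kappa> \<longleftrightarrow>
     is_polytope \<eta> \<kappa> \<and>
     (\<forall>v. v extreme_point_of Delta \<eta> \<kappa> \<longrightarrow> card {i. v \<in> facet \<eta> \<kappa> i} = DIM('a))"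

definition chamber :: "('n::finite \<Rightarrow> 'a::euclidean_space) \<Rightarrow> real ^ 'n \<Rightarrow> (real ^ 'n) set" where
  "chamber \<eta> \<kappa> = connected_component_set {\<kappa>'. simple_polytope \<eta> \<kappa>'} \<kappa>"

definition center_of_mass :: "'a::euclidean_space set \<Rightarrow> 'a" where
  "center_of_mass D = (1 / measure lborel D) *\<^sub>R (LINT x:D|lborel. x)"

definition mass_linear ::
  "('n::finite \<Rightarrow> 'a::euclidean_space) \<Rightarrow> real ^ 'n \<Rightarrow> 'a \<Rightarrow> bool" where
  "mass_linear \<eta> \<kappa> H \<longleftrightarrow>
     (\<exists>(\<gamma> :: 'n \<Rightarrow> real) (C :: real). \<forall>\<kappa>' \<in> chamber \<eta> \<kappa>.
        H \<bullet> center_of_mass (Delta \<eta> \<kappa>') = (\<Sum>i\<in>UNIV. \<gamma> i * \<kappa>' $ i) + C)"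

definition symmetric_facet ::
  "('n::finite \<Rightarrow> 'a::euclidean_space) \<Rightarrow> real ^ 'n \<Rightarrow> 'a \<Rightarrow> 'n \<Rightarrow> bool" where
  "symmetric_facet \<eta> \<kappa> H i \<longleftrightarrow>
     (\<forall>\<kappa>' \<in> chamber \<eta> \<kappa>. \<forall>\<kappa>'' \<in> chamber \<eta> \<kappa>.
        (\<forall>j. j \<noteq> i \<longrightarrow> \<kappa>' $ j = \<kappa>'' $ j) \<longrightarrow>
        H \<bullet> center_of_mass (Delta \<eta> \<kappa>') = H \<bullet> center_of_mass (Delta \<eta> \<kappa>''))"

abbreviation asymmetric_facet ::
  "('n::finite \<Rightarrow> 'a::euclidean_space) \<Rightarrow> real ^ 'n \<Rightarrow> 'a \<Rightarrow> 'n \<Rightarrow> bool" where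
  "asymmetric_facet \<eta> \<kappa> H i \<equiv> \<not> symmetric_facet \<eta> \<kappa> H i"

definition pervasive_facet :: "('n::finite \<Rightarrow> 'a::euclidean_space) \<Rightarrow> real ^ 'n \<Rightarrow> 'n \<Rightarrow> bool" where
  "pervasive_facet \<eta> \<kappa> i \<longleftrightarrow> (\<forall>j. j \<noteq> i \<longrightarrow> facet \<eta> \<kappa> i \<inter> facet \<eta> \<kappa> j \<noteq> {})"

definition flat_facet :: "('n::finite \<Rightarrow> 'a::euclidean_space) \<Rightarrow> real ^ 'n \<Rightarrow> 'n \<Rightarrow> bool" where
  "flat_facet \<eta> \<kappa> i \<longleftrightarrow>
     (\<exists>S :: 'a set. subspace S \<and> dim S + 1 = DIM('a) \<and>
        (\<forall>j. j \<noteq> i \<and> facet \<eta> \<kappa> j \<inter> facet \<eta> \<kappa> i \<noteq> {} \<longrightarrow> \<eta> j \<in> S))"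

end

theory Submission
  imports Defs
begin

text \<open>
  Suppose that the facet \<open>i\<close> is asymmetric and disjoint from another facet \<open>j\<close>. Write \<open>V\<close> for the
  volume and \<open>M\<close> for the moment of \<open>H\<close>, so that \<open>M = V * L\<close> with \<open>L\<close> affine in the support numbers,
  and let \<open>\<gamma>\<close> be its linear coefficients; asymmetry gives \<open>\<gamma> i \<noteq> 0\<close>. Since the two facets are
  disjoint, the mixed second differences of \<open>V\<close> and of \<open>M\<close> in the directions \<open>i\<close> and \<open>j\<close> vanish near
  \<open>\<kappa>\<close>. Hence \<open>\<gamma> i * s * (V(\<kappa> + t e\<^sub>j) - V(\<kappa>)) + \<gamma> j * t * (V(\<kappa> + s e\<^sub>i) - V(\<kappa>)) = 0\<close> for small
  \<open>s\<close> and \<open>t\<close>, and comparing this identity at two base points shows that \<open>V\<close> is affine in the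
  \<open>i\<close>-th support number near \<open>\<kappa>\<close> (\<open>volume_affine_in_asymmetric_direction\<close>).

  Taking further differences in the directions of the facets \<open>k \<in> K\<close> that cut out an edge of the
  facet \<open>i\<close> localises this statement: the part of the polytope in a thin slab around that edge keeps
  its volume when the \<open>i\<close>-th facet is moved a little (\<open>slab_measure_invariant\<close>). Infinitesimally,
  the length of the edge does not change. Choose \<open>w\<close> with \<open>\<eta> i \<bullet> w = 1\<close> and \<open>\<eta> k \<bullet> w = 0\<close> for the other
  facets \<open>k\<close> at one end of the edge, and let \<open>b\<close> be the facet at the other end. Translating the slab
  along \<open>w\<close> maps it into the moved slab, or the moved slab into it, and misses a nonempty open set
  unless \<open>\<eta> b \<bullet> w = 0\<close>. Thus \<open>\<eta> b \<bullet> w = 0\<close> (\<open>edge_direction_constant\<close>): both ends of the edge have the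
  same \<open>w\<close>. As any two vertices of the facet \<open>i\<close> are joined by edges of that facet, one vector \<open>w\<close>
  serves for all of them (\<open>facet_vertex_walk\<close>), and the orthogonal complement of \<open>w\<close> is a hyperplane
  that contains the conormal of every other facet meeting the facet \<open>i\<close>.
\<close>

section \<open>Vertices and their active facets\<close>

text \<open>The indices of the defining inequalities that are equalities at \<open>x\<close>. The point \<open>x\<close> is not
  required to lie in the polytope.\<close>

definition active :: "('n::finite \<Rightarrow> 'a::euclidean_space) \<Rightarrow> real ^ 'n \<Rightarrow> 'a \<Rightarrow> 'n set" where
  "active \<eta> \<kappa> x = {i. \<eta> i \<bullet> x = \<kappa> $ i}"

lemma mem_Delta: "x \<in> Delta \<eta> \<kappa> \<longleftrightarrow> (\<forall>i. \<eta> i \<bullet> x \<le> \<kappa> $ i)"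
  by (auto simp: Delta_def)

lemma mem_facet: "x \<in> facet \<eta> \<kappa> i \<longleftrightarrow> x \<in> Delta \<eta> \<kappa> \<and> i \<in> active \<eta> \<kappa> x"
  by (auto simp: facet_def active_def)

lemma active_facets: "x \<in> Delta \<eta> \<kappa> \<Longrightarrow> {i. x \<in> facet \<eta> \<kappa> i} = active \<eta> \<kappa> x"
  by (auto simp: mem_facet)

lemma closed_Delta: "closed (Delta \<eta> \<kappa>)"
  unfolding Delta_def by (intro closed_INT ballI closed_halfspace_le)

lemma convex_Delta: "convex (Delta \<eta> \<kappa>)"
  unfolding Delta_def by (intro convex_INT ballI convex_halfspace_le)

lemma extreme_point_in: "v extreme_point_of S \<Longrightarrow> v \<in> S"
  by (simp add: extreme_point_of_def)

lemma eventually_slack: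
  fixes a x z :: "'a::euclidean_space"
  assumes "a \<bullet> x < c"
  shows "\<forall>\<^sub>F t in at_right 0. a \<bullet> (x + t *\<^sub>R z) < c"
proof -
  have "((\<lambda>t. a \<bullet> (x + t *\<^sub>R z)) \<longlongrightarrow> a \<bullet> (x + 0 *\<^sub>R z)) (at_right 0)"
    by (intro tendsto_intros)
  then show ?thesis using assms by (auto intro: order_tendstoD)
qed

lemma active_segment:
  assumes "x \<in> open_segment a b" "a \<in> Delta \<eta> \<kappa>" "b \<in> Delta \<eta> \<kappa>" "l \<in> active \<eta> \<kappa> x"
  shows "\<eta> l \<bullet> a = \<kappa> $ l \<and> \<eta> l \<bullet> b = \<kappa> $ l"
proof -
  obtain u where u: "0 < u" "u < 1" and x: "x = (1 - u) *\<^sub>R a + u *\<^sub>R b"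
    using assms(1) by (auto simp: in_segment)
  have ab: "\<eta> l \<bullet> a \<le> \<kappa> $ l" "\<eta> l \<bullet> b \<le> \<kappa> $ l"
    using assms(2,3) by (auto simp: mem_Delta)
  have "\<eta> l \<bullet> x = \<kappa> $ l" using assms(4) by (simp add: active_def)
  then have eq: "(1 - u) * (\<kappa> $ l - \<eta> l \<bullet> a) + u * (\<kappa> $ l - \<eta> l \<bullet> b) = 0"
    by (simp add: x inner_add_right algebra_simps)
  have "(1 - u) * (\<kappa> $ l - \<eta> l \<bullet> a) \<ge> 0" "u * (\<kappa> $ l - \<eta> l \<bullet> b) \<ge> 0"
    using u ab by auto
  then have "(1 - u) * (\<kappa> $ l - \<eta> l \<bullet> a) = 0" "u * (\<kappa> $ l - \<eta> l \<bullet> b) = 0"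
    using eq by linarith+
  then show ?thesis using u by auto
qed

text \<open>A point is a vertex if and only if the conormals active at it span the space; spanning is
  stated as the absence of a nonzero vector orthogonal to all of them.\<close>

lemma extreme_point_iff_active:
  assumes x: "x \<in> Delta \<eta> \<kappa>"
  shows "x extreme_point_of Delta \<eta> \<kappa> \<longleftrightarrow> (\<forall>z. (\<forall>l\<in>active \<eta> \<kappa> x. \<eta> l \<bullet> z = 0) \<longrightarrow> z = 0)"
proof (intro iffI allI impI)
  fix z assume ext: "x extreme_point_of Delta \<eta> \<kappa>" and z: "\<forall>l\<in>active \<eta> \<kappa> x. \<eta> l \<bullet> z = 0"
  have ev: "\<forall>\<^sub>F t in at_right 0. x + t *\<^sub>R y \<in> Delta \<eta> \<kappa>" if y: "\<forall>l\<in>active \<eta> \<kappa> x. \<eta> l \<bullet> y = 0" for y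
    unfolding mem_Delta
  proof (rule eventually_all_finite)
    fix l
    show "\<forall>\<^sub>F t in at_right 0. \<eta> l \<bullet> (x + t *\<^sub>R y) \<le> \<kappa> $ l"
    proof (cases "l \<in> active \<eta> \<kappa> x")
      case True
      then show ?thesis using y x by (simp add: inner_add_right mem_Delta)
    next
      case False
      then have "\<eta> l \<bullet> x < \<kappa> $ l" using x by (auto simp: active_def mem_Delta less_le)
      then show ?thesis by (rule eventually_mono[OF eventually_slack[where z = y]]) auto
    qed
  qed
  have "\<forall>\<^sub>F t in at_right 0. x + t *\<^sub>R z \<in> Delta \<eta> \<kappa> \<and> x + t *\<^sub>R (- z) \<in> Delta \<eta> \<kappa> \<and> (0::real) < t"
    using ev[of z] ev[of "- z"] z by (intro eventually_conj eventually_at_right_less) auto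
  then obtain t :: real where t: "x + t *\<^sub>R z \<in> Delta \<eta> \<kappa>" "x + t *\<^sub>R (- z) \<in> Delta \<eta> \<kappa>" "0 < t"
    using eventually_happens trivial_limit_at_right_real by blast
  show "z = 0"
  proof (rule ccontr)
    assume "z \<noteq> 0"
    then have ne: "x + t *\<^sub>R z \<noteq> x + t *\<^sub>R (- z)"
      using t(3) by (simp add: eq_neg_iff_add_eq_0 scaleR_2[symmetric])
    have "x = midpoint (x + t *\<^sub>R z) (x + t *\<^sub>R (- z))"
      by (simp add: midpoint_def scaleR_2[symmetric])
    then have "x \<in> open_segment (x + t *\<^sub>R z) (x + t *\<^sub>R (- z))"
      using ne midpoint_in_open_segment[of "x + t *\<^sub>R z" "x + t *\<^sub>R (- z)"] by simp
    then show False using ext t by (auto simp: extreme_point_of_def)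
  qed
next
  assume *: "\<forall>z. (\<forall>l\<in>active \<eta> \<kappa> x. \<eta> l \<bullet> z = 0) \<longrightarrow> z = 0"
  show "x extreme_point_of Delta \<eta> \<kappa>"
    unfolding extreme_point_of_def
  proof (intro conjI x ballI notI)
    fix a b assume ab: "a \<in> Delta \<eta> \<kappa>" "b \<in> Delta \<eta> \<kappa>" "x \<in> open_segment a b"
    have "\<forall>l\<in>active \<eta> \<kappa> x. \<eta> l \<bullet> (a - b) = 0"
      using active_segment[OF ab(3,1,2)] by (simp add: inner_diff_right)
    then have "a = b" using * by auto
    then show False using ab(3) by simp
  qed
qed

lemma face_has_vertex:
  assumes bd: "bounded (Delta \<eta> \<kappa>)" and x: "x \<in> Delta \<eta> \<kappa>" and J: "J \<subseteq> active \<eta> \<kappa> x"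
  obtains v where "v extreme_point_of Delta \<eta> \<kappa>" "J \<subseteq> active \<eta> \<kappa> v"
proof -
  define G where "G = Delta \<eta> \<kappa> \<inter> (\<Inter>j\<in>J. {y. \<eta> j \<bullet> y = \<kappa> $ j})"
  have "compact (Delta \<eta> \<kappa>)" using bd closed_Delta compact_eq_bounded_closed by blast
  then have "compact G"
    unfolding G_def by (intro compact_Int_closed closed_INT ballI closed_hyperplane)
  moreover have "convex G"
    unfolding G_def by (intro convex_Int convex_Delta convex_INT ballI convex_hyperplane)
  moreover have "G \<noteq> {}" using x J by (auto simp: G_def active_def)
  ultimately obtain v where v: "v extreme_point_of G"
    using extreme_point_exists_convex by blast
  have vG: "v \<in> G" using v by (rule extreme_point_in)
  have JA: "J \<subseteq> active \<eta> \<kappa> v" using vG by (auto simp: G_def active_def)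
  have "v extreme_point_of Delta \<eta> \<kappa>"
    unfolding extreme_point_of_def
  proof (intro conjI ballI notI)
    show "v \<in> Delta \<eta> \<kappa>" using vG by (simp add: G_def)
    fix a b assume ab: "a \<in> Delta \<eta> \<kappa>" "b \<in> Delta \<eta> \<kappa>" "v \<in> open_segment a b"
    have "a \<in> G" "b \<in> G"
      using active_segment[OF ab(3,1,2)] JA ab by (auto simp: G_def)
    then show False using v ab(3) by (auto simp: extreme_point_of_def)
  qed
  then show thesis using JA that by blast
qed

lemma span_active:
  assumes "v extreme_point_of Delta \<eta> \<kappa>"
  shows "span (\<eta> ` active \<eta> \<kappa> v) = UNIV"
proof (rule ccontr)
  assume "span (\<eta> ` active \<eta> \<kappa> v) \<noteq> UNIV"
  then obtain z where "z \<noteq> 0" "\<forall>x\<in>span (\<eta> ` active \<eta> \<kappa> v). z \<bullet> x = 0"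
    using span_not_UNIV_orthogonal by blast
  moreover from this have "\<forall>l\<in>active \<eta> \<kappa> v. \<eta> l \<bullet> z = 0"
    by (metis imageI inner_commute span_base)
  ultimately show False
    using assms extreme_point_iff_active[OF extreme_point_in[OF assms]] by blast
qed

lemma card_active_ge:
  assumes "v extreme_point_of Delta \<eta> \<kappa>"
  shows "DIM('a) \<le> card (active \<eta> \<kappa> (v::'a::euclidean_space))"
proof -
  have "DIM('a) = dim (\<eta> ` active \<eta> \<kappa> v)"
    by (metis span_active[OF assms] dim_span dim_UNIV)
  also have "\<dots> \<le> card (\<eta> ` active \<eta> \<kappa> v)" by (intro dim_le_card') simp
  also have "\<dots> \<le> card (active \<eta> \<kappa> v)" by (intro card_image_le) simp
  finally show ?thesis .
qed

lemma simple_card_active: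
  assumes "simple_polytope \<eta> \<kappa>" "v extreme_point_of Delta \<eta> \<kappa>"
  shows "card (active \<eta> \<kappa> (v::'a::euclidean_space)) = DIM('a)"
  using assms active_facets[OF extreme_point_in[OF assms(2)]] by (metis simple_polytope_def)

text \<open>At a vertex of a simple polytope the active conormals form a basis, so the values of a vector
  against them can be prescribed.\<close>

lemma simple_dual_vector:
  fixes \<eta> :: "'n::finite \<Rightarrow> 'a::euclidean_space"
  assumes "simple_polytope \<eta> \<kappa>" "v extreme_point_of Delta \<eta> \<kappa>"
  obtains z where "\<And>l. l \<in> active \<eta> \<kappa> v \<Longrightarrow> \<eta> l \<bullet> z = g l"
proof -
  let ?I = "active \<eta> \<kappa> v"
  have card: "card ?I = DIM('a)" using simple_card_active[OF assms] .
  have dim: "dim (\<eta> ` ?I) = DIM('a)"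
    by (metis span_active[OF assms(2)] dim_span dim_UNIV)
  have "card (\<eta> ` ?I) \<ge> DIM('a)"
    using dim dim_le_card'[of "\<eta> ` ?I"] by simp
  moreover have "card (\<eta> ` ?I) \<le> card ?I" by (intro card_image_le) simp
  ultimately have ceq: "card (\<eta> ` ?I) = card ?I" using card by simp
  then have inj: "inj_on \<eta> ?I" by (intro eq_card_imp_inj_on) simp_all
  have ind: "independent (\<eta> ` ?I)"
    using card_le_dim_spanning[of "\<eta> ` ?I" UNIV] span_active[OF assms(2)] ceq card by simp
  obtain f :: "'a \<Rightarrow> real" where f: "linear f" "\<forall>x\<in>\<eta> ` ?I. f x = g (inv_into ?I \<eta> x)"
    using linear_independent_extend[OF ind, of "\<lambda>x. g (inv_into ?I \<eta> x)"] by auto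
  define z where "z = (\<Sum>b\<in>Basis. f b *\<^sub>R b)"
  have fz: "f x = x \<bullet> z" for x
  proof -
    have "f x = f (\<Sum>b\<in>Basis. (x \<bullet> b) *\<^sub>R b)" by (simp add: euclidean_representation)
    also have "\<dots> = (\<Sum>b\<in>Basis. (x \<bullet> b) * f b)"
      using f(1) by (simp add: linear_sum linear_scale)
    also have "\<dots> = x \<bullet> z" by (simp add: z_def inner_sum_right mult.commute)
    finally show ?thesis .
  qed
  show thesis
  proof (rule that)
    fix l assume "l \<in> ?I"
    then show "\<eta> l \<bullet> z = g l" using f(2) inj by (auto simp flip: fz)
  qed
qed

section \<open>Stability of simple polytopes under small changes of the support numbers\<close>

lemma simple_bounded: "simple_polytope \<eta> \<kappa> \<Longrightarrow> bounded (Delta \<eta> \<kappa>)"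
  by (simp add: simple_polytope_def is_polytope_def)

lemma simple_facet_nonempty:
  assumes "simple_polytope \<eta> \<kappa>"
  shows "facet \<eta> \<kappa> i \<noteq> {}"
proof
  assume e: "facet \<eta> \<kappa> i = {}"
  obtain a b where ab: "a \<noteq> 0" "affine hull (facet \<eta> \<kappa> i) = {x. a \<bullet> x = b}"
    using assms unfolding simple_polytope_def is_polytope_def by blast
  have "a \<bullet> ((b / (a \<bullet> a)) *\<^sub>R a) = b" using ab(1) by simp
  then have "affine hull (facet \<eta> \<kappa> i) \<noteq> {}" unfolding ab(2) by blast
  then show False using e by simp
qed

lemma simple_facet_vertex:
  assumes "simple_polytope \<eta> \<kappa>"
  obtains v where "v extreme_point_of Delta \<eta> \<kappa>" "i \<in> active \<eta> \<kappa> v"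
proof -
  obtain x where "x \<in> facet \<eta> \<kappa> i" using simple_facet_nonempty[OF assms] by blast
  then have "x \<in> Delta \<eta> \<kappa>" "{i} \<subseteq> active \<eta> \<kappa> x" by (auto simp: mem_facet)
  then show thesis using face_has_vertex[OF simple_bounded[OF assms]] that by (metis insert_subset)
qed

text \<open>Moving from \<open>v\<close> in a direction that points into the active halfspaces, except possibly those
  of \<open>K\<close>, makes all inequalities outside \<open>K\<close> strict for a short time.\<close>

lemma vertex_move_eventually:
  assumes v: "v \<in> Delta \<eta> \<kappa>"
    and z: "\<And>l. l \<in> active \<eta> \<kappa> v \<Longrightarrow> l \<notin> K \<Longrightarrow> \<eta> l \<bullet> z < 0"
  shows "\<forall>\<^sub>F t in at_right 0. \<forall>l. l \<notin> K \<longrightarrow> \<eta> l \<bullet> (v + t *\<^sub>R z) < \<kappa> $ l"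
proof (rule eventually_all_finite)
  fix l
  show "\<forall>\<^sub>F t in at_right 0. l \<notin> K \<longrightarrow> \<eta> l \<bullet> (v + t *\<^sub>R z) < \<kappa> $ l"
  proof (cases "l \<in> active \<eta> \<kappa> v")
    case True
    then have "\<eta> l \<bullet> v = \<kappa> $ l" by (simp add: active_def)
    then have "l \<notin> K \<longrightarrow> \<eta> l \<bullet> (v + t *\<^sub>R z) < \<kappa> $ l" if "0 < t" for t
      using z[OF True] that by (simp add: inner_add_right mult_pos_neg)
    then show ?thesis by (intro eventually_at_rightI[of 0 1]) auto
  next
    case False
    then have "\<eta> l \<bullet> v < \<kappa> $ l" using v by (auto simp: active_def mem_Delta less_le)
    then show ?thesis by (rule eventually_mono[OF eventually_slack[where z = z]]) auto
  qed
qed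

lemma simple_facet_interior_point:
  assumes "simple_polytope \<eta> \<kappa>"
  obtains x where "\<eta> i \<bullet> x = \<kappa> $ i" "\<And>l. l \<noteq> i \<Longrightarrow> \<eta> l \<bullet> x < \<kappa> $ l"
proof -
  obtain v where v: "v extreme_point_of Delta \<eta> \<kappa>" "i \<in> active \<eta> \<kappa> v"
    using simple_facet_vertex[OF assms, of i] by blast
  obtain z where z: "\<And>l. l \<in> active \<eta> \<kappa> v \<Longrightarrow> \<eta> l \<bullet> z = (if l = i then 0 else -1)"
    using simple_dual_vector[OF assms v(1), where g = "\<lambda>l. if l = i then 0 else -1"] by blast
  have "\<forall>\<^sub>F t in at_right 0. \<forall>l. l \<notin> {i} \<longrightarrow> \<eta> l \<bullet> (v + t *\<^sub>R z) < \<kappa> $ l"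
    using z by (intro vertex_move_eventually extreme_point_in v) auto
  then obtain t :: real where t: "\<forall>l. l \<notin> {i} \<longrightarrow> \<eta> l \<bullet> (v + t *\<^sub>R z) < \<kappa> $ l"
    using eventually_happens trivial_limit_at_right_real by blast
  have "\<eta> i \<bullet> (v + t *\<^sub>R z) = \<kappa> $ i"
    using v(2) z[OF v(2)] by (simp add: inner_add_right active_def)
  then show thesis using t that by blast
qed

lemma simple_conormal_nonzero:
  assumes "simple_polytope \<eta> \<kappa>"
  shows "\<eta> i \<noteq> 0"
proof
  assume "\<eta> i = 0"
  obtain v where v: "v extreme_point_of Delta \<eta> \<kappa>" "i \<in> active \<eta> \<kappa> v"
    using simple_facet_vertex[OF assms, of i] by blast
  obtain z where z: "\<And>l. l \<in> active \<eta> \<kappa> v \<Longrightarrow> \<eta> l \<bullet> z = 1"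
    using simple_dual_vector[OF assms v(1), where g = "\<lambda>l. 1"] by blast
  show False using z[OF v(2)] \<open>\<eta> i = 0\<close> by simp
qed

lemma open_slices:
  fixes \<eta> :: "'n::finite \<Rightarrow> 'a::euclidean_space" and a b :: "'n \<Rightarrow> real"
  shows "open {x. \<forall>l. P l \<longrightarrow> a l < \<eta> l \<bullet> x}" "open {x. \<forall>l. P l \<longrightarrow> \<eta> l \<bullet> x < b l}"
proof -
  have "{x. \<forall>l. P l \<longrightarrow> a l < \<eta> l \<bullet> x} = (\<Inter>l\<in>{l. P l}. {x. a l < \<eta> l \<bullet> x})"
    "{x. \<forall>l. P l \<longrightarrow> \<eta> l \<bullet> x < b l} = (\<Inter>l\<in>{l. P l}. {x. \<eta> l \<bullet> x < b l})" by auto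
  then show "open {x. \<forall>l. P l \<longrightarrow> a l < \<eta> l \<bullet> x}" "open {x. \<forall>l. P l \<longrightarrow> \<eta> l \<bullet> x < b l}"
    by (simp_all add: open_INT open_halfspace_lt open_halfspace_gt)
qed

lemma facet_interior_point_push:
  fixes \<eta> :: "'n::finite \<Rightarrow> 'a::euclidean_space"
  assumes x: "\<eta> i \<bullet> x = \<kappa> $ i" "\<And>l. l \<noteq> i \<Longrightarrow> \<eta> l \<bullet> x < \<kappa> $ l" and i: "\<eta> i \<noteq> 0" and s: "s > 0"
  obtains y where "\<And>l. \<eta> l \<bullet> y < \<kappa> $ l" "\<kappa> $ i - s < \<eta> i \<bullet> y"
proof -
  have "\<forall>\<^sub>F t in at_right 0. \<forall>l. l \<noteq> i \<longrightarrow> \<eta> l \<bullet> (x + t *\<^sub>R (- \<eta> i)) < \<kappa> $ l"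
  proof (rule eventually_all_finite)
    fix l show "\<forall>\<^sub>F t in at_right 0. l \<noteq> i \<longrightarrow> \<eta> l \<bullet> (x + t *\<^sub>R (- \<eta> i)) < \<kappa> $ l"
      using x(2)[of l] eventually_slack[of "\<eta> l" x "\<kappa> $ l" "- \<eta> i"] by (cases "l = i") auto
  qed
  moreover have "\<forall>\<^sub>F t in at_right 0. (- \<eta> i) \<bullet> (x + t *\<^sub>R (- \<eta> i)) < - \<kappa> $ i + s"
    using s x(1) by (intro eventually_slack) simp
  ultimately have "\<forall>\<^sub>F t in at_right 0. (\<forall>l. l \<noteq> i \<longrightarrow> \<eta> l \<bullet> (x + t *\<^sub>R (- \<eta> i)) < \<kappa> $ l) \<and>
      (- \<eta> i) \<bullet> (x + t *\<^sub>R (- \<eta> i)) < - \<kappa> $ i + s \<and> (0::real) < t"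
    by (intro eventually_conj eventually_at_right_less)
  then obtain t :: real where t: "\<forall>l. l \<noteq> i \<longrightarrow> \<eta> l \<bullet> (x + t *\<^sub>R (- \<eta> i)) < \<kappa> $ l"
      "(- \<eta> i) \<bullet> (x + t *\<^sub>R (- \<eta> i)) < - \<kappa> $ i + s" "0 < t"
    using eventually_happens trivial_limit_at_right_real by blast
  have "\<eta> i \<bullet> (x + t *\<^sub>R (- \<eta> i)) < \<kappa> $ i"
    using x(1) t(3) i by (simp add: inner_diff_right)
  then have "\<eta> l \<bullet> (x + t *\<^sub>R (- \<eta> i)) < \<kappa> $ l" for l
    using t(1) by (cases "l = i") auto
  then show thesis using t(2) that[of "x + t *\<^sub>R (- \<eta> i)"] by simp
qed

text \<open>Boundedness does not depend on the support numbers: with an interior point \<open>c\<close> of the given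
  polytope, every other one is contained in its dilation about \<open>c\<close> by a large factor \<open>q\<close>.\<close>

lemma bounded_Delta_all:
  fixes \<eta> :: "'n::finite \<Rightarrow> 'a::euclidean_space"
  assumes "simple_polytope \<eta> \<kappa>"
  shows "bounded (Delta \<eta> \<kappa>')"
proof -
  obtain i :: 'n where True by simp
  obtain x where x: "\<eta> i \<bullet> x = \<kappa> $ i" "\<And>l. l \<noteq> i \<Longrightarrow> \<eta> l \<bullet> x < \<kappa> $ l"
    using simple_facet_interior_point[OF assms, of i] by blast
  obtain c where c: "\<And>l. \<eta> l \<bullet> c < \<kappa> $ l"
    using facet_interior_point_push[OF x simple_conormal_nonzero[OF assms] zero_less_one] by blast
  define r where "r l = \<bar>\<kappa>' $ l - \<eta> l \<bullet> c\<bar> / (\<kappa> $ l - \<eta> l \<bullet> c)" for l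
  define q where "q = 1 + (\<Sum>l\<in>UNIV. r l)"
  have r0: "r l \<ge> 0" for l using c[of l] by (simp add: r_def)
  have q: "q > 0" using sum_nonneg[of UNIV r] r0 by (simp add: q_def add_pos_nonneg)
  have rq: "r l \<le> q" for l
    using member_le_sum[of l UNIV r] r0 by (simp add: q_def)
  have "Delta \<eta> \<kappa>' \<subseteq> (\<lambda>y. c + q *\<^sub>R (y - c)) ` Delta \<eta> \<kappa>"
  proof
    fix x assume x: "x \<in> Delta \<eta> \<kappa>'"
    define y where "y = c + (1 / q) *\<^sub>R (x - c)"
    have "\<eta> l \<bullet> y \<le> \<kappa> $ l" for l
    proof -
      have "\<eta> l \<bullet> x - \<eta> l \<bullet> c \<le> \<bar>\<kappa>' $ l - \<eta> l \<bullet> c\<bar>" using x by (auto simp: mem_Delta dest: spec[of _ l])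
      also have "\<dots> = r l * (\<kappa> $ l - \<eta> l \<bullet> c)" using c[of l] by (simp add: r_def)
      also have "\<dots> \<le> q * (\<kappa> $ l - \<eta> l \<bullet> c)" using c[of l] rq by (intro mult_right_mono) auto
      finally have "(\<eta> l \<bullet> x - \<eta> l \<bullet> c) / q \<le> \<kappa> $ l - \<eta> l \<bullet> c" using q by (simp add: field_simps)
      then show ?thesis by (simp add: y_def inner_add_right inner_diff_right)
    qed
    then have "y \<in> Delta \<eta> \<kappa>" by (simp add: mem_Delta)
    moreover have "x = c + q *\<^sub>R (y - c)" using q by (simp add: y_def)
    ultimately show "x \<in> (\<lambda>y. c + q *\<^sub>R (y - c)) ` Delta \<eta> \<kappa>" by blast
  qed
  moreover have "bounded ((\<lambda>y. c + q *\<^sub>R (y - c)) ` Delta \<eta> \<kappa>)"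
  proof -
    have "(\<lambda>y. c + q *\<^sub>R (y - c)) ` Delta \<eta> \<kappa> = (+) (c - q *\<^sub>R c) ` (*\<^sub>R) q ` Delta \<eta> \<kappa>"
      by (simp add: image_image algebra_simps)
    then show ?thesis
      using simple_bounded[OF assms] by (simp add: bounded_translation bounded_scaling)
  qed
  ultimately show ?thesis by (rule bounded_subset[rotated])
qed

text \<open>By compactness, inequalities that are nearly equalities at a common nearly feasible point are
  all active at a common vertex. This controls the combinatorics of all nearby polytopes at once.\<close>

lemma nearly_active_near_vertex:
  fixes \<eta> :: "'n::finite \<Rightarrow> 'a::euclidean_space"
  assumes s: "simple_polytope \<eta> \<kappa>"
  obtains \<epsilon> where "\<epsilon> > 0"
    "\<And>x J. (\<And>l. \<eta> l \<bullet> x \<le> \<kappa> $ l + \<epsilon>) \<Longrightarrow> (\<And>l. l \<in> J \<Longrightarrow> \<kappa> $ l - \<epsilon> \<le> \<eta> l \<bullet> x) \<Longrightarrow>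
       \<exists>v. v extreme_point_of Delta \<eta> \<kappa> \<and> J \<subseteq> active \<eta> \<kappa> v"
proof -
  define C where "C J e = {x. (\<forall>l. \<eta> l \<bullet> x \<le> \<kappa> $ l + e) \<and> (\<forall>l\<in>J. \<kappa> $ l - e \<le> \<eta> l \<bullet> x)}"
    for J :: "'n set" and e :: real
  have mono: "C J e \<subseteq> C J e'" if "e \<le> e'" for J e e'
  proof
    fix x assume x: "x \<in> C J e"
    have "\<eta> l \<bullet> x \<le> \<kappa> $ l + e'" for l
      using x that unfolding C_def by (auto dest!: spec[of _ l])
    moreover have "\<kappa> $ l - e' \<le> \<eta> l \<bullet> x" if "l \<in> J" for l
      using x that \<open>e \<le> e'\<close> unfolding C_def by (auto dest!: bspec[of _ _ l])
    ultimately show "x \<in> C J e'" unfolding C_def by blast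
  qed
  have comp: "compact (C J e)" for J e
  proof -
    have *: "C J e = Delta \<eta> (\<chi> l. \<kappa> $ l + e) \<inter> (\<Inter>l\<in>J. {x. \<kappa> $ l - e \<le> \<eta> l \<bullet> x})"
      by (auto simp: C_def mem_Delta)
    have "closed (C J e)"
      unfolding * by (intro closed_Int closed_Delta closed_INT ballI closed_halfspace_ge)
    moreover have "bounded (C J e)"
      unfolding * by (rule bounded_subset[OF bounded_Delta_all[OF s]]) auto
    ultimately show ?thesis using compact_eq_bounded_closed by blast
  qed
  have ex: "\<exists>e>0. C J e \<noteq> {} \<longrightarrow> (\<exists>v. v extreme_point_of Delta \<eta> \<kappa> \<and> J \<subseteq> active \<eta> \<kappa> v)" for J
  proof (rule ccontr)
    assume *: "\<not> ?thesis"
    have ne: "C J e \<noteq> {}" if "e > 0" for e using * that by blast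
    have nov: "\<not> (\<exists>v. v extreme_point_of Delta \<eta> \<kappa> \<and> J \<subseteq> active \<eta> \<kappa> v)"
      using * zero_less_one by blast
    define F where "F n = C J (1 / real (Suc n))" for n
    \<comment> \<open>A point in the intersection of these nested compact sets has all of \<open>J\<close> active.\<close>
    have "\<Inter> (range F) \<noteq> {}"
    proof (rule compact_nest)
      show "compact (F n)" "F n \<noteq> {}" for n
        using ne comp by (simp_all add: F_def)
    next
      fix m n :: nat assume "m \<le> n"
      then show "F n \<subseteq> F m" unfolding F_def by (intro mono) (simp add: field_simps)
    qed
    then obtain x where x: "\<And>n. x \<in> F n" by blast
    have lim: "(\<lambda>n. c + 1 / real (Suc n)) \<longlonglongrightarrow> c" "(\<lambda>n. c - 1 / real (Suc n)) \<longlonglongrightarrow> c" for c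
      using tendsto_add[OF tendsto_const[of c] LIMSEQ_Suc[OF lim_1_over_n]]
        tendsto_diff[OF tendsto_const[of c] LIMSEQ_Suc[OF lim_1_over_n]] by simp_all
    have le: "\<eta> l \<bullet> x \<le> \<kappa> $ l" for l
      using x by (intro LIMSEQ_le_const[OF lim(1)]) (auto simp: F_def C_def)
    moreover have "\<kappa> $ l \<le> \<eta> l \<bullet> x" if "l \<in> J" for l
      using x that by (intro LIMSEQ_le_const2[OF lim(2)]) (auto simp: F_def C_def)
    ultimately have "x \<in> Delta \<eta> \<kappa>" "J \<subseteq> active \<eta> \<kappa> x"
      by (auto simp: mem_Delta active_def intro: antisym)
    then obtain v where "v extreme_point_of Delta \<eta> \<kappa>" "J \<subseteq> active \<eta> \<kappa> v"
      using face_has_vertex[OF simple_bounded[OF s]] by metis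
    then show False using nov by blast
  qed
  then obtain e where e: "\<And>J. e J > 0"
    "\<And>J. C J (e J) \<noteq> {} \<Longrightarrow> \<exists>v. v extreme_point_of Delta \<eta> \<kappa> \<and> J \<subseteq> active \<eta> \<kappa> v" by metis
  define \<epsilon> where "\<epsilon> = Min (range e)"
  show thesis
  proof (rule that)
    show "\<epsilon> > 0" using e(1) by (auto simp: \<epsilon>_def)
    fix x J assume "\<And>l. \<eta> l \<bullet> x \<le> \<kappa> $ l + \<epsilon>" "\<And>l. l \<in> J \<Longrightarrow> \<kappa> $ l - \<epsilon> \<le> \<eta> l \<bullet> x"
    then have "x \<in> C J \<epsilon>" by (auto simp: C_def)
    moreover have "\<epsilon> \<le> e J" by (simp add: \<epsilon>_def)
    ultimately show "\<exists>v. v extreme_point_of Delta \<eta> \<kappa> \<and> J \<subseteq> active \<eta> \<kappa> v"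
      using mono e(2) by blast
  qed
qed

lemma simple_polytope_open:
  fixes \<eta> :: "'n::finite \<Rightarrow> 'a::euclidean_space"
  assumes s: "simple_polytope \<eta> \<kappa>"
  obtains \<epsilon> where "\<epsilon> > 0" "\<And>\<kappa>'. (\<And>l. \<bar>\<kappa>' $ l - \<kappa> $ l\<bar> \<le> \<epsilon>) \<Longrightarrow> simple_polytope \<eta> \<kappa>'"
proof -
  obtain e where e: "e > 0"
    and near: "\<And>x J. (\<And>l. \<eta> l \<bullet> x \<le> \<kappa> $ l + e) \<Longrightarrow> (\<And>l. l \<in> J \<Longrightarrow> \<kappa> $ l - e \<le> \<eta> l \<bullet> x) \<Longrightarrow>
       \<exists>v. v extreme_point_of Delta \<eta> \<kappa> \<and> J \<subseteq> active \<eta> \<kappa> v"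
    using nearly_active_near_vertex[OF s] by metis
  have ev: "\<forall>\<^sub>F \<epsilon> in at_right 0. \<forall>\<kappa>'. (\<forall>l. \<bar>\<kappa>' $ l - \<kappa> $ l\<bar> \<le> \<epsilon>) \<longrightarrow>
      (\<exists>x. \<eta> i \<bullet> x = \<kappa>' $ i \<and> (\<forall>l. l \<noteq> i \<longrightarrow> \<eta> l \<bullet> x < \<kappa>' $ l))" for i
  proof -
    obtain x where x: "\<eta> i \<bullet> x = \<kappa> $ i" "\<And>l. l \<noteq> i \<Longrightarrow> \<eta> l \<bullet> x < \<kappa> $ l"
      using simple_facet_interior_point[OF s, of i] by blast
    define y where "y = (1 / (\<eta> i \<bullet> \<eta> i)) *\<^sub>R \<eta> i"
    have y: "\<eta> i \<bullet> y = 1" using simple_conormal_nonzero[OF s] by (simp add: y_def)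
    have "\<forall>\<^sub>F \<epsilon> in at_right 0. \<forall>l. l \<noteq> i \<longrightarrow> \<epsilon> * (\<bar>\<eta> l \<bullet> y\<bar> + 1) < \<kappa> $ l - \<eta> l \<bullet> x"
    proof (rule eventually_all_finite)
      fix l
      have "((\<lambda>\<epsilon>. \<epsilon> * (\<bar>\<eta> l \<bullet> y\<bar> + 1)) \<longlongrightarrow> 0 * (\<bar>\<eta> l \<bullet> y\<bar> + 1)) (at_right 0)"
        by (intro tendsto_intros)
      then show "\<forall>\<^sub>F \<epsilon> in at_right 0. l \<noteq> i \<longrightarrow> \<epsilon> * (\<bar>\<eta> l \<bullet> y\<bar> + 1) < \<kappa> $ l - \<eta> l \<bullet> x"
        using x(2)[of l] by (cases "l = i") (auto intro: order_tendstoD)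
    qed
    then show ?thesis
    proof (rule eventually_mono, intro allI impI)
      fix \<epsilon> :: real and \<kappa>' :: "real ^ 'n"
      assume \<epsilon>: "\<forall>l. l \<noteq> i \<longrightarrow> \<epsilon> * (\<bar>\<eta> l \<bullet> y\<bar> + 1) < \<kappa> $ l - \<eta> l \<bullet> x"
        and \<kappa>': "\<forall>l. \<bar>\<kappa>' $ l - \<kappa> $ l\<bar> \<le> \<epsilon>"
      define d where "d = \<kappa>' $ i - \<kappa> $ i"
      have "\<eta> l \<bullet> (x + d *\<^sub>R y) < \<kappa>' $ l" if "l \<noteq> i" for l
      proof -
        have "d * (\<eta> l \<bullet> y) \<le> \<bar>d\<bar> * \<bar>\<eta> l \<bullet> y\<bar>" by (metis abs_ge_self abs_mult)
        also have "\<dots> \<le> \<epsilon> * \<bar>\<eta> l \<bullet> y\<bar>" using \<kappa>' by (intro mult_right_mono) (auto simp: d_def)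
        finally have "d * (\<eta> l \<bullet> y) \<le> \<epsilon> * \<bar>\<eta> l \<bullet> y\<bar>" .
        moreover have "\<bar>\<kappa>' $ l - \<kappa> $ l\<bar> \<le> \<epsilon>" using \<kappa>' by blast
        moreover have "\<epsilon> * \<bar>\<eta> l \<bullet> y\<bar> + \<epsilon> < \<kappa> $ l - \<eta> l \<bullet> x"
          using \<epsilon> that by (simp add: algebra_simps)
        ultimately show ?thesis by (simp add: inner_add_right)
      qed
      moreover have "\<eta> i \<bullet> (x + d *\<^sub>R y) = \<kappa>' $ i" using x(1) y by (simp add: inner_add_right d_def)
      ultimately show "\<exists>x. \<eta> i \<bullet> x = \<kappa>' $ i \<and> (\<forall>l. l \<noteq> i \<longrightarrow> \<eta> l \<bullet> x < \<kappa>' $ l)" by blast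
    qed
  qed
  have "\<forall>\<^sub>F \<epsilon> in at_right 0. (\<forall>i. \<forall>\<kappa>'. (\<forall>l. \<bar>\<kappa>' $ l - \<kappa> $ l\<bar> \<le> \<epsilon>) \<longrightarrow>
      (\<exists>x. \<eta> i \<bullet> x = \<kappa>' $ i \<and> (\<forall>l. l \<noteq> i \<longrightarrow> \<eta> l \<bullet> x < \<kappa>' $ l))) \<and> \<epsilon> \<in> {0<..<e}"
    using e by (intro eventually_conj eventually_all_finite ev eventually_at_right_real)
  then obtain \<epsilon> where fp: "\<And>i \<kappa>'. (\<forall>l. \<bar>\<kappa>' $ l - \<kappa> $ l\<bar> \<le> \<epsilon>) \<Longrightarrow>
      \<exists>x. \<eta> i \<bullet> x = \<kappa>' $ i \<and> (\<forall>l. l \<noteq> i \<longrightarrow> \<eta> l \<bullet> x < \<kappa>' $ l)" and \<epsilon>: "0 < \<epsilon>" "\<epsilon> < e"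
    using eventually_happens'[OF trivial_limit_at_right_real] by fastforce
  show thesis
  proof (rule that[OF \<epsilon>(1)])
    fix \<kappa>' assume k: "\<And>l. \<bar>\<kappa>' $ l - \<kappa> $ l\<bar> \<le> \<epsilon>"
    have fp': "\<exists>x. \<eta> i \<bullet> x = \<kappa>' $ i \<and> (\<forall>l. l \<noteq> i \<longrightarrow> \<eta> l \<bullet> x < \<kappa>' $ l)" for i
      using fp k by blast
    show "simple_polytope \<eta> \<kappa>'"
      unfolding simple_polytope_def is_polytope_def
    proof (intro conjI allI impI)
      show "bounded (Delta \<eta> \<kappa>')" using bounded_Delta_all[OF s] .
    next
      obtain i :: 'n where True by simp
      obtain x where x: "\<eta> i \<bullet> x = \<kappa>' $ i" "\<And>l. l \<noteq> i \<Longrightarrow> \<eta> l \<bullet> x < \<kappa>' $ l" using fp' by blast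
      obtain c where c: "\<And>l. \<eta> l \<bullet> c < \<kappa>' $ l"
        using facet_interior_point_push[OF x simple_conormal_nonzero[OF s] zero_less_one] by blast
      let ?U = "{x. \<forall>l. True \<longrightarrow> \<eta> l \<bullet> x < \<kappa>' $ l}"
      have "affine hull ?U = UNIV"
        using c by (intro affine_hull_open open_slices) auto
      moreover have "?U \<subseteq> Delta \<eta> \<kappa>'" by (auto simp: mem_Delta less_imp_le)
      ultimately show "affine hull (Delta \<eta> \<kappa>') = UNIV"
        using hull_mono[of ?U "Delta \<eta> \<kappa>'" affine] by auto
    next
      fix i
      obtain x where x: "\<eta> i \<bullet> x = \<kappa>' $ i" "\<And>l. l \<noteq> i \<Longrightarrow> \<eta> l \<bullet> x < \<kappa>' $ l" using fp' by blast
      let ?h = "{x. \<eta> i \<bullet> x = \<kappa>' $ i}" and ?U = "{x. \<forall>l. l \<noteq> i \<longrightarrow> \<eta> l \<bullet> x < \<kappa>' $ l}"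
      have "affine hull (?h \<inter> ?U) = ?h"
        using x affine_hull_affine_Int_open[of ?h ?U] open_slices(2)[of "\<lambda>l. l \<noteq> i"]
        by (auto simp: affine_hyperplane hull_same)
      moreover have "?h \<inter> ?U \<subseteq> facet \<eta> \<kappa>' i"
        by (auto simp: facet_def mem_Delta) (metis order.order_iff_strict)
      moreover have "affine hull (facet \<eta> \<kappa>' i) \<subseteq> ?h"
        by (intro hull_minimal affine_hyperplane) (auto simp: facet_def)
      ultimately have "affine hull (facet \<eta> \<kappa>' i) = ?h"
        using hull_mono[of "?h \<inter> ?U" "facet \<eta> \<kappa>' i" affine] by auto
      then show "\<exists>a b. a \<noteq> 0 \<and> affine hull facet \<eta> \<kappa>' i = {x. a \<bullet> x = b}"
        using simple_conormal_nonzero[OF s] by blast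
    next
      fix v assume v: "v extreme_point_of Delta \<eta> \<kappa>'"
      have vD: "v \<in> Delta \<eta> \<kappa>'" using extreme_point_in[OF v] .
      have "\<eta> l \<bullet> v \<le> \<kappa> $ l + e" for l
        using vD k[of l] \<epsilon> by (auto simp: mem_Delta dest!: spec[of _ l])
      \<comment> \<open>The facets active at \<open>v\<close> are among those at a vertex of the unperturbed polytope.\<close>
      moreover have "\<kappa> $ l - e \<le> \<eta> l \<bullet> v" if "l \<in> active \<eta> \<kappa>' v" for l
        using that k[of l] \<epsilon> by (auto simp: active_def)
      ultimately obtain u where u: "u extreme_point_of Delta \<eta> \<kappa>" "active \<eta> \<kappa>' v \<subseteq> active \<eta> \<kappa> u"
        using near by meson
      have "card (active \<eta> \<kappa>' v) \<le> DIM('a)"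
        using card_mono[OF _ u(2)] simple_card_active[OF s u(1)] by simp
      then show "card {i. v \<in> facet \<eta> \<kappa>' i} = DIM('a)"
        using card_active_ge[OF v] active_facets[OF vD] by simp
    qed
  qed
qed

lemma chamber_contains_box:
  fixes \<eta> :: "'n::finite \<Rightarrow> 'a::euclidean_space"
  assumes "\<And>\<kappa>'. (\<And>l. \<bar>\<kappa>' $ l - \<kappa> $ l\<bar> \<le> \<epsilon>) \<Longrightarrow> simple_polytope \<eta> \<kappa>'" "0 \<le> \<epsilon>"
    and "\<And>l. \<bar>\<kappa>' $ l - \<kappa> $ l\<bar> \<le> \<epsilon>"
  shows "\<kappa>' \<in> chamber \<eta> \<kappa>"
proof -
  let ?B = "cbox (\<kappa> - (\<chi> l. \<epsilon>)) (\<kappa> + (\<chi> l. \<epsilon>))"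
  have B: "x \<in> ?B \<longleftrightarrow> (\<forall>l. \<bar>x $ l - \<kappa> $ l\<bar> \<le> \<epsilon>)" for x
    by (auto simp: mem_box_cart abs_le_iff) (smt (verit))+
  have "connected ?B" by (intro convex_connected convex_box)
  moreover have "\<kappa> \<in> ?B" using assms(2) by (simp only: B) simp
  moreover have "?B \<subseteq> {\<kappa>'. simple_polytope \<eta> \<kappa>'}" using assms(1) by (auto simp only: B)
  moreover have "\<kappa>' \<in> ?B" using assms(3) by (simp only: B) simp
  ultimately have "?B \<subseteq> chamber \<eta> \<kappa>"
    unfolding chamber_def by (intro connected_component_maximal)
  then show ?thesis using \<open>\<kappa>' \<in> ?B\<close> by (rule subsetD)
qed

section \<open>Walking along the edges of a facet\<close>

lemma finite_vertices:
  fixes \<eta> :: "'n::finite \<Rightarrow> 'a::euclidean_space"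
  shows "finite {v. v extreme_point_of Delta \<eta> \<kappa>}"
proof (rule inj_on_finite[where B = "UNIV :: 'n set set"])
  show "inj_on (active \<eta> \<kappa>) {v. v extreme_point_of Delta \<eta> \<kappa>}"
  proof (rule inj_onI, clarify)
    fix u v assume u: "u extreme_point_of Delta \<eta> \<kappa>" and eq: "active \<eta> \<kappa> u = active \<eta> \<kappa> v"
    have "\<forall>l\<in>active \<eta> \<kappa> u. \<eta> l \<bullet> (u - v) = 0"
      using eq by (auto simp: active_def inner_diff_right)
    then have "u - v = 0" using u extreme_point_iff_active[OF extreme_point_in[OF u]] by blast
    then show "u = v" by simp
  qed
qed auto

text \<open>Leaving the facet \<open>k\<close> at the vertex \<open>u\<close> along the edge direction \<open>d\<close> leads to a second vertex,
  at which a facet \<open>b\<close> replaces \<open>k\<close>. The last conclusion says that the line through the edge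
  contains no further vertices.\<close>

lemma edge_exit:
  fixes \<eta> :: "'n::finite \<Rightarrow> 'a::euclidean_space"
  assumes s: "simple_polytope \<eta> \<kappa>" and u: "u extreme_point_of Delta \<eta> \<kappa>"
    and k: "k \<in> active \<eta> \<kappa> u" "\<eta> k \<bullet> d = -1"
    and d: "\<And>l. l \<in> active \<eta> \<kappa> u \<Longrightarrow> l \<noteq> k \<Longrightarrow> \<eta> l \<bullet> d = 0"
  obtains t b where "t > 0" "b \<notin> active \<eta> \<kappa> u" "(u + t *\<^sub>R d) extreme_point_of Delta \<eta> \<kappa>"
    "active \<eta> \<kappa> (u + t *\<^sub>R d) = insert b (active \<eta> \<kappa> u - {k})"
    "\<And>p. p extreme_point_of Delta \<eta> \<kappa> \<Longrightarrow> active \<eta> \<kappa> u - {k} \<subseteq> active \<eta> \<kappa> p \<Longrightarrow>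
       p = u \<or> p = u + t *\<^sub>R d"
proof -
  have uD: "u \<in> Delta \<eta> \<kappa>" using extreme_point_in[OF u] .
  have uniq: "z = 0" if "\<forall>l\<in>active \<eta> \<kappa> u. \<eta> l \<bullet> z = 0" for z
    using u extreme_point_iff_active[OF uD] that by blast
  have d0: "d \<noteq> 0" using k(2) by auto
  define P where "P = {b. \<eta> b \<bullet> d > 0}"
  have "P \<noteq> {}"
  proof
    assume "P = {}"
    then have le: "\<eta> l \<bullet> d \<le> 0" for l by (auto simp: P_def not_less)
    have ray: "u + t *\<^sub>R d \<in> Delta \<eta> \<kappa>" if "t \<ge> 0" for t
      unfolding mem_Delta
    proof
      fix l
      have "t * (\<eta> l \<bullet> d) \<le> 0" using le that by (simp add: mult_nonneg_nonpos)
      moreover have "\<eta> l \<bullet> u \<le> \<kappa> $ l" using uD by (simp add: mem_Delta)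
      ultimately show "\<eta> l \<bullet> (u + t *\<^sub>R d) \<le> \<kappa> $ l" by (simp add: inner_add_right)
    qed
    obtain B where B: "\<And>x. x \<in> Delta \<eta> \<kappa> \<Longrightarrow> norm x \<le> B"
      using simple_bounded[OF s] by (auto simp: bounded_iff)
    have "norm u \<le> B" using B uD by blast
    then have B0: "0 \<le> B" using norm_ge_zero[of u] by linarith
    define t where "t = (B + norm u + 1) / norm d"
    have t0: "t \<ge> 0" using B0 by (simp add: t_def)
    have "norm (t *\<^sub>R d) = B + norm u + 1" using d0 B0 by (simp add: t_def)
    moreover have "norm (t *\<^sub>R d) \<le> norm (u + t *\<^sub>R d) + norm u"
      using norm_triangle_ineq4[of "u + t *\<^sub>R d" u] by simp
    ultimately show False using B[OF ray[OF t0]] by linarith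
  qed
  \<comment> \<open>\<open>r b\<close> is the time at which the ray from \<open>u\<close> crosses the hyperplane of \<open>b\<close>.\<close>
  define r where "r b = (\<kappa> $ b - \<eta> b \<bullet> u) / (\<eta> b \<bullet> d)" for b
  define t where "t = Min (r ` P)"
  have "t \<in> r ` P" unfolding t_def using \<open>P \<noteq> {}\<close> by (intro Min_in) auto
  then obtain b where b: "b \<in> P" "t = r b" by blast
  have tmin: "t \<le> r l" if "l \<in> P" for l using that by (simp add: t_def)
  have bna: "b \<notin> active \<eta> \<kappa> u"
    using b(1) k d[of b] by (cases "b = k") (auto simp: P_def)
  then have "\<eta> b \<bullet> u < \<kappa> $ b" using uD by (auto simp: active_def mem_Delta less_le)
  then have t0: "t > 0" using b by (simp add: r_def P_def)
  define u' where "u' = u + t *\<^sub>R d"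
  have eta: "\<eta> l \<bullet> u' = \<eta> l \<bullet> u + t * (\<eta> l \<bullet> d)" for l by (simp add: u'_def inner_add_right)
  have u'D: "u' \<in> Delta \<eta> \<kappa>"
    unfolding mem_Delta
  proof
    fix l
    have ul: "\<eta> l \<bullet> u \<le> \<kappa> $ l" using uD by (simp add: mem_Delta)
    show "\<eta> l \<bullet> u' \<le> \<kappa> $ l"
    proof (cases "l \<in> P")
      case True
      then show ?thesis using tmin[OF True] by (simp add: eta r_def P_def field_simps)
    next
      case False
      then have "t * (\<eta> l \<bullet> d) \<le> 0" using t0 by (simp add: P_def mult_nonneg_nonpos)
      then show ?thesis using ul by (simp add: eta)
    qed
  qed
  have sub: "insert b (active \<eta> \<kappa> u - {k}) \<subseteq> active \<eta> \<kappa> u'"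
    using b d by (auto simp: active_def eta r_def P_def)
  have u': "u' extreme_point_of Delta \<eta> \<kappa>"
    unfolding extreme_point_iff_active[OF u'D]
  proof (intro allI impI)
    fix z assume z: "\<forall>l\<in>active \<eta> \<kappa> u'. \<eta> l \<bullet> z = 0"
    have "\<eta> l \<bullet> (z + (\<eta> k \<bullet> z) *\<^sub>R d) = 0" if "l \<in> active \<eta> \<kappa> u" for l
      using that z sub k d[of l] by (cases "l = k") (auto simp: inner_add_right)
    then have zz: "z + (\<eta> k \<bullet> z) *\<^sub>R d = 0" using uniq by blast
    have "\<eta> b \<bullet> z = 0" using z sub by blast
    then have "(\<eta> k \<bullet> z) * (\<eta> b \<bullet> d) = 0"
      using arg_cong[OF zz, of "inner (\<eta> b)"] by (simp add: inner_add_right)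
    then have "\<eta> k \<bullet> z = 0" using b by (simp add: P_def)
    then show "z = 0" using zz by simp
  qed
  have "card (insert b (active \<eta> \<kappa> u - {k})) = card (active \<eta> \<kappa> u')"
    using bna k(1) simple_card_active[OF s u] simple_card_active[OF s u'] card_Suc_Diff1[OF _ k(1)]
    by simp
  then have act: "active \<eta> \<kappa> u' = insert b (active \<eta> \<kappa> u - {k})"
    using sub by (metis card_subset_eq finite_code)
  have only: "p = u \<or> p = u'"
    if p: "p extreme_point_of Delta \<eta> \<kappa>" "active \<eta> \<kappa> u - {k} \<subseteq> active \<eta> \<kappa> p" for p
  proof -
    have pD: "p \<in> Delta \<eta> \<kappa>" using extreme_point_in[OF p(1)] .
    define q where "q = \<kappa> $ k - \<eta> k \<bullet> p"
    have q0: "q \<ge> 0" using pD by (simp add: q_def mem_Delta)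
    have "\<eta> l \<bullet> (p - (u + q *\<^sub>R d)) = 0" if l: "l \<in> active \<eta> \<kappa> u" for l
    proof (cases "l = k")
      case True
      then show ?thesis using k l by (simp add: q_def active_def inner_diff_right inner_add_right)
    next
      case False
      then have "l \<in> active \<eta> \<kappa> p" using p(2) l by blast
      then show ?thesis using l False d[OF l False]
        by (simp add: active_def inner_diff_right inner_add_right)
    qed
    then have "p - (u + q *\<^sub>R d) = 0" using uniq by blast
    then have pe: "p = u + q *\<^sub>R d" by simp
    have "\<eta> b \<bullet> p \<le> \<kappa> $ b" using pD by (simp add: mem_Delta)
    then have "\<eta> b \<bullet> u + q * (\<eta> b \<bullet> d) \<le> \<kappa> $ b" by (simp add: pe inner_add_right)
    moreover have "\<eta> b \<bullet> u + t * (\<eta> b \<bullet> d) = \<kappa> $ b" "\<eta> b \<bullet> d > 0"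
      using b by (auto simp: r_def P_def)
    ultimately have "q * (\<eta> b \<bullet> d) \<le> t * (\<eta> b \<bullet> d)" by linarith
    then have qt: "q \<le> t" using \<open>\<eta> b \<bullet> d > 0\<close> by simp
    show ?thesis
    proof (rule ccontr)
      assume *: "\<not> ?thesis"
      then have "q \<noteq> 0" "q \<noteq> t" by (auto simp: pe u'_def)
      then have q: "0 < q" "q < t" using q0 qt by auto
      have "p = (1 - q / t) *\<^sub>R u + (q / t) *\<^sub>R u'"
        using t0 by (simp add: pe u'_def algebra_simps)
      moreover have "0 < q / t" "q / t < 1" using q t0 by auto
      moreover have "u \<noteq> u'" using t0 d0 by (simp add: u'_def)
      ultimately have "p \<in> open_segment u u'" unfolding in_segment by blast
      then show False using p(1) uD u'D by (auto simp: extreme_point_of_def)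
    qed
  qed
  show thesis using that[OF t0 bna] u' act only unfolding u'_def by blast
qed

text \<open>A property of vertices that is inherited along the edges of the facet \<open>i\<close> passes from one vertex
  of that facet to every other one. The argument is that of the simplex algorithm: among the
  vertices of the facet with the property, take one that maximises the functional \<open>f\<close>, the sum of
  the conormals active at the target \<open>v\<close>. No edge of the facet improves on it, so it attains the
  maximum of \<open>f\<close> on the facet, and this happens at \<open>v\<close> only.\<close>

lemma facet_vertex_walk:
  fixes \<eta> :: "'n::finite \<Rightarrow> 'a::euclidean_space"
  assumes s: "simple_polytope \<eta> \<kappa>"
    and u0: "u0 extreme_point_of Delta \<eta> \<kappa>" "i \<in> active \<eta> \<kappa> u0" "Q u0"
    and v: "v extreme_point_of Delta \<eta> \<kappa>" "i \<in> active \<eta> \<kappa> v"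
    and step: "\<And>u u' k b. Q u \<Longrightarrow> u extreme_point_of Delta \<eta> \<kappa> \<Longrightarrow> u' extreme_point_of Delta \<eta> \<kappa> \<Longrightarrow>
      i \<in> active \<eta> \<kappa> u \<Longrightarrow> k \<in> active \<eta> \<kappa> u \<Longrightarrow> k \<noteq> i \<Longrightarrow> b \<notin> active \<eta> \<kappa> u \<Longrightarrow>
      active \<eta> \<kappa> u' = insert b (active \<eta> \<kappa> u - {k}) \<Longrightarrow>
      (\<And>p. p extreme_point_of Delta \<eta> \<kappa> \<Longrightarrow> active \<eta> \<kappa> u - {k} \<subseteq> active \<eta> \<kappa> p \<Longrightarrow> p = u \<or> p = u') \<Longrightarrow>
      Q u'"
  shows "Q v"
proof -
  define f where "f = (\<Sum>l\<in>active \<eta> \<kappa> v. \<eta> l)"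
  have fx: "f \<bullet> x = (\<Sum>l\<in>active \<eta> \<kappa> v. \<eta> l \<bullet> x)" for x by (simp add: f_def inner_sum_left)
  define S where "S = {u. u extreme_point_of Delta \<eta> \<kappa> \<and> i \<in> active \<eta> \<kappa> u \<and> Q u}"
  have fin: "finite S" by (rule finite_subset[OF _ finite_vertices[of \<eta> \<kappa>]]) (auto simp: S_def)
  have "S \<noteq> {}" using u0 by (auto simp: S_def)
  then have "Max ((\<bullet>) f ` S) \<in> (\<bullet>) f ` S" using fin by (intro Max_in) auto
  then obtain u where uS: "u \<in> S" and umax': "Max ((\<bullet>) f ` S) = f \<bullet> u" by auto
  have umax: "f \<bullet> x \<le> f \<bullet> u" if "x \<in> S" for x
    using that fin umax' Max_ge[of "(\<bullet>) f ` S" "f \<bullet> x"] by simp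
  have u: "u extreme_point_of Delta \<eta> \<kappa>" "i \<in> active \<eta> \<kappa> u" "Q u" using uS by (auto simp: S_def)
  have uD: "u \<in> Delta \<eta> \<kappa>" and vD: "v \<in> Delta \<eta> \<kappa>" using extreme_point_in u v by blast+
  let ?I = "active \<eta> \<kappa> u"
  have "\<exists>d. \<forall>l\<in>?I. \<eta> l \<bullet> d = (if l = k then -1 else 0)" for k
    by (rule simple_dual_vector[OF s u(1), where g = "\<lambda>l. if l = k then -1 else 0"]) (intro exI ballI)
  then obtain d where d: "\<And>k l. l \<in> ?I \<Longrightarrow> \<eta> l \<bullet> d k = (if l = k then -1 else 0)" by metis
  have nonpos: "f \<bullet> d k \<le> 0" if k: "k \<in> ?I" "k \<noteq> i" for k
  proof (rule ccontr)
    assume "\<not> ?thesis"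
    then have pos: "f \<bullet> d k > 0" by simp
    obtain t b where e: "t > 0" "b \<notin> ?I" "(u + t *\<^sub>R d k) extreme_point_of Delta \<eta> \<kappa>"
      "active \<eta> \<kappa> (u + t *\<^sub>R d k) = insert b (?I - {k})"
      "\<And>p. p extreme_point_of Delta \<eta> \<kappa> \<Longrightarrow> ?I - {k} \<subseteq> active \<eta> \<kappa> p \<Longrightarrow> p = u \<or> p = u + t *\<^sub>R d k"
      using edge_exit[OF s u(1) k(1), of "d k"] d k(1) by auto
    have "Q (u + t *\<^sub>R d k)" by (rule step[OF u(3) u(1) e(3) u(2) k e(2) e(4) e(5)])
    then have "u + t *\<^sub>R d k \<in> S" using e(3,4) u(2) k(2) by (simp add: S_def)
    from umax[OF this] show False using pos e(1) by (simp add: inner_add_right mult_le_0_iff)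
  qed
  \<comment> \<open>Expand \<open>v - u\<close> in the edge directions at \<open>u\<close>: the coefficients are nonnegative, and that of the
    direction leaving the facet \<open>i\<close> is zero.\<close>
  have "v - u = (\<Sum>k\<in>?I. (\<kappa> $ k - \<eta> k \<bullet> v) *\<^sub>R d k)" (is "_ = ?w")
  proof -
    have "\<eta> l \<bullet> (v - u - ?w) = 0" if l: "l \<in> ?I" for l
    proof -
      have "\<eta> l \<bullet> ?w = (\<Sum>k\<in>?I. if l = k then - (\<kappa> $ k - \<eta> k \<bullet> v) else 0)"
        unfolding inner_sum_right by (intro sum.cong refl) (simp add: d[OF l])
      also have "\<dots> = - (\<kappa> $ l - \<eta> l \<bullet> v)" using l by simp
      finally show ?thesis using l by (simp add: inner_diff_right active_def)
    qed
    then have "v - u - ?w = 0" using u(1) extreme_point_iff_active[OF uD] by blast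
    then show ?thesis by simp
  qed
  then have "f \<bullet> (v - u) = (\<Sum>k\<in>?I. (\<kappa> $ k - \<eta> k \<bullet> v) * (f \<bullet> d k))"
    by (simp add: inner_sum_right)
  also have "\<dots> \<le> 0"
  proof (rule sum_nonpos)
    fix k assume k: "k \<in> ?I"
    show "(\<kappa> $ k - \<eta> k \<bullet> v) * (f \<bullet> d k) \<le> 0"
    proof (cases "k = i")
      case True
      then show ?thesis using v(2) by (simp add: active_def)
    next
      case False
      then show ?thesis using nonpos[OF k False] vD by (intro mult_nonneg_nonpos) (auto simp: mem_Delta)
    qed
  qed
  finally have fvu: "f \<bullet> v \<le> f \<bullet> u" by (simp add: inner_diff_right)
  have ule: "\<eta> l \<bullet> u \<le> \<eta> l \<bullet> v" if "l \<in> active \<eta> \<kappa> v" for l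
    using that uD by (simp add: active_def mem_Delta)
  then have "(\<Sum>l\<in>active \<eta> \<kappa> v. \<eta> l \<bullet> v - \<eta> l \<bullet> u) = 0"
    using fvu sum_nonneg[of "active \<eta> \<kappa> v" "\<lambda>l. \<eta> l \<bullet> v - \<eta> l \<bullet> u"]
    unfolding sum_subtractf fx by simp
  then have "\<forall>l\<in>active \<eta> \<kappa> v. \<eta> l \<bullet> v - \<eta> l \<bullet> u = 0"
    using ule by (subst (asm) sum_nonneg_eq_0_iff) auto
  then have "v - u = 0"
    using v(1) extreme_point_iff_active[OF vD] by (metis inner_diff_right)
  then show ?thesis using u(3) by simp
qed

section \<open>Volume and moment as functions of the support numbers\<close>

lemma axis_entry: "axis i s $ l = (if l = i then s else (0::real))"
  by (simp add: axis_def)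

lemma bounded_borel_finite:
  assumes "bounded (S :: 'a::euclidean_space set)" "S \<in> sets borel"
  shows "S \<in> fmeasurable lborel"
  using assms emeasure_bounded_finite[OF assms(1)] by (intro fmeasurableI) auto

lemma measure_less_open_gap:
  fixes A B U :: "'a::euclidean_space set"
  assumes A: "A \<in> sets borel" and B: "B \<in> sets borel" "bounded B" and AB: "A \<subseteq> B"
    and U: "open U" "U \<noteq> {}" "U \<subseteq> B - A"
  shows "measure lborel A < measure lborel B"
proof -
  have fB: "B \<in> fmeasurable lborel" using bounded_borel_finite B by blast
  have fA: "A \<in> fmeasurable lborel" using bounded_borel_finite A bounded_subset[OF B(2) AB] by blast
  obtain c where "c \<in> U" using U(2) by blast
  then obtain r where r: "r > 0" "ball c r \<subseteq> U" using U(1) open_contains_ball by blast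
  have "0 < measure lborel (ball c r)" using r(1) by (rule content_ball_pos)
  also have "\<dots> \<le> measure lborel (B - A)"
    using r(2) U(3) fA fB by (intro measure_mono_fmeasurable) auto
  also have "\<dots> = measure lborel B - measure lborel A"
    using fA fB AB by (intro measure_Diff) (auto simp: fmeasurable_def)
  finally show ?thesis by simp
qed

lemma borel_Delta: "Delta \<eta> \<kappa> \<in> sets borel"
  using closed_Delta by (rule borel_closed)

lemma volume_strict_mono:
  fixes \<eta> :: "'n::finite \<Rightarrow> 'a::euclidean_space"
  assumes s: "simple_polytope \<eta> (\<kappa> + axis j t)" and t: "t > 0"
  shows "measure lborel (Delta \<eta> \<kappa>) < measure lborel (Delta \<eta> (\<kappa> + axis j t))"
proof -
  let ?\<kappa> = "\<kappa> + axis j t"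
  obtain x where x: "\<eta> j \<bullet> x = ?\<kappa> $ j" "\<And>l. l \<noteq> j \<Longrightarrow> \<eta> l \<bullet> x < ?\<kappa> $ l"
    using simple_facet_interior_point[OF s, of j] by blast
  obtain y where y: "\<And>l. \<eta> l \<bullet> y < ?\<kappa> $ l" "?\<kappa> $ j - t < \<eta> j \<bullet> y"
    using facet_interior_point_push[OF x simple_conormal_nonzero[OF s] t] by blast
  let ?U = "{x. \<forall>l. True \<longrightarrow> \<eta> l \<bullet> x < ?\<kappa> $ l} \<inter> {x. \<kappa> $ j < \<eta> j \<bullet> x}"
  show ?thesis
  proof (rule measure_less_open_gap[OF borel_Delta borel_Delta simple_bounded[OF s]])
    show "Delta \<eta> \<kappa> \<subseteq> Delta \<eta> ?\<kappa>"
      using t unfolding Delta_def vector_add_component axis_entry by (auto simp: add_increasing2)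
    show "open ?U" by (intro open_Int open_slices open_halfspace_gt)
    have "\<kappa> $ j < \<eta> j \<bullet> y" using y(2) by (simp add: axis_entry)
    then show "?U \<noteq> {}" using y(1) by blast
    show "?U \<subseteq> Delta \<eta> ?\<kappa> - Delta \<eta> \<kappa>"
      by (auto simp only: mem_Delta Int_iff mem_Collect_eq Diff_iff subset_iff not_le not_all less_imp_le)
  qed
qed

lemma volume_pos:
  assumes s: "simple_polytope \<eta> \<kappa>"
  shows "0 < measure lborel (Delta \<eta> \<kappa>)"
proof -
  have eq: "\<kappa> + axis undefined (-1) + axis undefined 1 = \<kappa>"
    by (simp add: vec_eq_iff axis_entry)
  have "measure lborel (Delta \<eta> (\<kappa> + axis undefined (-1))) < measure lborel (Delta \<eta> \<kappa>)"
    using volume_strict_mono[of \<eta> "\<kappa> + axis undefined (-1)" undefined 1, unfolded eq, OF s] by simp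
  then show ?thesis using measure_nonneg[of lborel "Delta \<eta> (\<kappa> + axis undefined (-1))"] by linarith
qed

text \<open>If no point of the largest polytope exceeds both old support numbers \<open>\<kappa> $ i\<close> and \<open>\<kappa> $ j\<close>, then
  the largest polytope is the union of the two intermediate ones, whose intersection is the smallest
  one. So additive set functions have zero mixed second difference.\<close>

lemma second_difference:
  fixes \<eta> :: "'n::finite \<Rightarrow> 'a::euclidean_space"
  assumes bd: "\<And>\<kappa>'. bounded (Delta \<eta> \<kappa>')" and st: "0 \<le> s" "0 \<le> t" and ij: "i \<noteq> j"
    and disj: "\<And>x. x \<in> Delta \<eta> (\<kappa> + axis i s + axis j t) \<Longrightarrow> \<eta> i \<bullet> x \<le> \<kappa> $ i \<or> \<eta> j \<bullet> x \<le> \<kappa> $ j"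
  shows "measure lborel (Delta \<eta> (\<kappa> + axis i s + axis j t)) + measure lborel (Delta \<eta> \<kappa>) =
      measure lborel (Delta \<eta> (\<kappa> + axis i s)) + measure lborel (Delta \<eta> (\<kappa> + axis j t))"
    and "(LINT x:Delta \<eta> (\<kappa> + axis i s + axis j t)|lborel. x) + (LINT x:Delta \<eta> \<kappa>|lborel. x) =
      (LINT x:Delta \<eta> (\<kappa> + axis i s)|lborel. x) + (LINT x:Delta \<eta> (\<kappa> + axis j t)|lborel. x)"
proof -
  let ?A = "Delta \<eta> (\<kappa> + axis i s + axis j t)" and ?B = "Delta \<eta> (\<kappa> + axis i s)"
    and ?C = "Delta \<eta> (\<kappa> + axis j t)" and ?D = "Delta \<eta> \<kappa>"
  have D: "?B \<inter> ?C = ?D" and A: "?B \<union> ?C = ?A"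
  proof -
    have 1: "x \<in> ?A \<longleftrightarrow> (\<forall>l. \<eta> l \<bullet> x \<le> \<kappa> $ l + (if l = i then s else 0) + (if l = j then t else 0))" for x
      by (simp add: mem_Delta axis_entry)
    have 2: "x \<in> ?B \<longleftrightarrow> (\<forall>l. \<eta> l \<bullet> x \<le> \<kappa> $ l + (if l = i then s else 0))" for x
      by (simp add: mem_Delta axis_entry)
    have 3: "x \<in> ?C \<longleftrightarrow> (\<forall>l. \<eta> l \<bullet> x \<le> \<kappa> $ l + (if l = j then t else 0))" for x
      by (simp add: mem_Delta axis_entry)
    have "x \<in> ?B \<inter> ?C \<longleftrightarrow> x \<in> ?D" for x
    proof -
      have e: "\<eta> l \<bullet> x \<le> \<kappa> $ l \<longleftrightarrow> \<eta> l \<bullet> x \<le> \<kappa> $ l + (if l = i then s else 0) \<and>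
          \<eta> l \<bullet> x \<le> \<kappa> $ l + (if l = j then t else 0)" for l
        using st ij by (cases "l = i"; cases "l = j") auto
      show ?thesis unfolding Int_iff 2 3 unfolding mem_Delta e by (rule all_conj_distrib[symmetric])
    qed
    then show "?B \<inter> ?C = ?D" by blast
    have "x \<in> ?A" if "x \<in> ?B \<or> x \<in> ?C" for x
    proof -
      have "\<kappa> $ l + (if l = i then s else 0) \<le> \<kappa> $ l + (if l = i then s else 0) + (if l = j then t else 0)"
        "\<kappa> $ l + (if l = j then t else 0) \<le> \<kappa> $ l + (if l = i then s else 0) + (if l = j then t else 0)" for l
        using st by auto
      then show ?thesis using that unfolding 1 2 3 by (meson order_trans)
    qed
    moreover have "x \<in> ?B \<or> x \<in> ?C" if x: "x \<in> ?A" for x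
    proof -
      note x1 = x[unfolded 1, rule_format]
      from disj[OF x] show ?thesis
      proof
        assume i: "\<eta> i \<bullet> x \<le> \<kappa> $ i"
        have "\<eta> l \<bullet> x \<le> \<kappa> $ l + (if l = j then t else 0)" for l
          using x1[of l] i ij by (cases "l = i") auto
        then show ?thesis unfolding 3 by blast
      next
        assume j: "\<eta> j \<bullet> x \<le> \<kappa> $ j"
        have "\<eta> l \<bullet> x \<le> \<kappa> $ l + (if l = i then s else 0)" for l
          using x1[of l] j ij by (cases "l = j") auto
        then show ?thesis unfolding 2 by blast
      qed
    qed
    ultimately show "?B \<union> ?C = ?A" by blast
  qed
  have fm: "Delta \<eta> \<kappa>' \<in> fmeasurable lborel" for \<kappa>'
    using bounded_borel_finite[OF bd borel_Delta] .
  show "measure lborel ?A + measure lborel ?D = measure lborel ?B + measure lborel ?C"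
    using measure_Un3[OF fm fm, of "\<kappa> + axis i s" "\<kappa> + axis j t"] by (simp add: A D)
  have int: "integrable lborel (\<lambda>x. indicator (Delta \<eta> \<kappa>') x *\<^sub>R x)" for \<kappa>'
    using bd by (intro borel_integrable_compact continuous_on_id) (simp add: compact_eq_bounded_closed closed_Delta)
  have ind: "indicator ?A x *\<^sub>R x + indicator ?D x *\<^sub>R x = indicator ?B x *\<^sub>R x + indicator ?C x *\<^sub>R x" for x
    unfolding A[symmetric] D[symmetric] by (auto simp: indicator_def)
  show "(LINT x:?A|lborel. x) + (LINT x:?D|lborel. x) = (LINT x:?B|lborel. x) + (LINT x:?C|lborel. x)"
    unfolding set_lebesgue_integral_def
    by (simp only: Bochner_Integration.integral_add[OF int int, symmetric] ind)
qed

lemma center_of_mass_moment: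
  assumes "simple_polytope \<eta> \<kappa>"
  shows "measure lborel (Delta \<eta> \<kappa>) * (H \<bullet> center_of_mass (Delta \<eta> \<kappa>)) =
    H \<bullet> (LINT x:Delta \<eta> \<kappa>|lborel. x)"
  using volume_pos[OF assms] by (simp add: center_of_mass_def)

text \<open>The facets \<open>i\<close> and \<open>j\<close> are assumed to stay disjoint for all support numbers within \<open>2 * \<delta>\<close> of \<open>\<kappa>\<close>.
  The conclusion, a vanishing second difference in the \<open>i\<close>-th support number, is stated for the
  step \<open>\<delta>\<close> only, which is the one used for the slabs.\<close>

lemma volume_affine_in_asymmetric_direction:
  fixes \<eta> :: "'n::finite \<Rightarrow> 'a::euclidean_space"
  assumes s: "\<And>\<kappa>'. (\<And>l. \<bar>\<kappa>' $ l - \<kappa> $ l\<bar> \<le> 2 * \<delta>) \<Longrightarrow> simple_polytope \<eta> \<kappa>'"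
    and L: "\<And>\<kappa>'. (\<And>l. \<bar>\<kappa>' $ l - \<kappa> $ l\<bar> \<le> 2 * \<delta>) \<Longrightarrow>
      H \<bullet> center_of_mass (Delta \<eta> \<kappa>') = (\<Sum>i\<in>UNIV. \<gamma> i * \<kappa>' $ i) + C"
    and disj: "\<And>x. (\<And>l. \<eta> l \<bullet> x \<le> \<kappa> $ l + 2 * \<delta>) \<Longrightarrow>
      \<eta> i \<bullet> x < \<kappa> $ i - 2 * \<delta> \<or> \<eta> j \<bullet> x < \<kappa> $ j - 2 * \<delta>"
    and ij: "i \<noteq> j" and gi: "\<gamma> i \<noteq> 0" and \<delta>: "\<delta> > 0"
    and \<kappa>': "\<And>l. \<bar>\<kappa>' $ l - \<kappa> $ l\<bar> \<le> \<delta>"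
  shows "measure lborel (Delta \<eta> (\<kappa>' + axis i \<delta>)) - measure lborel (Delta \<eta> \<kappa>') =
    measure lborel (Delta \<eta> \<kappa>') - measure lborel (Delta \<eta> (\<kappa>' + axis i (- \<delta>)))"
proof -
  have bd: "bounded (Delta \<eta> q)" for q by (rule bounded_Delta_all[OF s[of \<kappa>]]) (use \<delta> in simp)
  define V where "V q = measure lborel (Delta \<eta> q)" for q
  define M where "M q = H \<bullet> (LINT x:Delta \<eta> q|lborel. x)" for q
  define Lf where "Lf q = (\<Sum>i\<in>UNIV. \<gamma> i * q $ i) + C" for q :: "real ^ 'n"
  have VM: "M q = V q * Lf q" if "\<And>l. \<bar>q $ l - \<kappa> $ l\<bar> \<le> 2 * \<delta>" for q
    using center_of_mass_moment[OF s[OF that], of H] L[OF that] by (simp add: V_def M_def Lf_def)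
  have ax0: "axis l 0 = (0 :: real ^ 'n)" for l by (simp add: vec_eq_iff axis_entry)
  have Lf: "Lf (q + axis l r) = Lf q + \<gamma> l * r" for q l r
  proof -
    have "(\<Sum>i\<in>UNIV. \<gamma> i * axis l r $ i) = (\<Sum>i\<in>UNIV. if i = l then \<gamma> l * r else 0)"
      by (intro sum.cong refl) (simp add: axis_entry)
    then show ?thesis by (simp add: Lf_def distrib_left sum.distrib)
  qed
  \<comment> \<open>The base point \<open>q\<close> may lie \<open>2 * \<delta>\<close> below \<open>\<kappa>\<close> in the \<open>i\<close>-th coordinate, because the identities are
    needed both at \<open>\<kappa>'\<close> and at \<open>\<kappa>' - \<delta> e\<^sub>i\<close>.\<close>
  have two: "V (q + axis i \<delta> + axis j \<delta>) + V q = V (q + axis i \<delta>) + V (q + axis j \<delta>)"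
    "\<gamma> i * (V (q + axis j \<delta>) - V q) + \<gamma> j * (V (q + axis i \<delta>) - V q) = 0"
    if q: "\<And>l. - \<delta> - (if l = i then \<delta> else 0) \<le> q $ l - \<kappa> $ l" "\<And>l. q $ l - \<kappa> $ l \<le> \<delta>" for q
  proof -
    have near: "\<bar>(q + axis i a + axis j b) $ l - \<kappa> $ l\<bar> \<le> 2 * \<delta>" if "a \<in> {0, \<delta>}" "b \<in> {0, \<delta>}" for a b l
      using that q[of l] \<delta> ij by (auto simp: axis_entry abs_le_iff split: if_splits)
    have "\<eta> i \<bullet> x \<le> q $ i \<or> \<eta> j \<bullet> x \<le> q $ j" if x: "x \<in> Delta \<eta> (q + axis i \<delta> + axis j \<delta>)" for x
    proof -
      have "\<eta> l \<bullet> x \<le> \<kappa> $ l + 2 * \<delta>" for l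
      proof -
        have "\<eta> l \<bullet> x \<le> (q + axis i \<delta> + axis j \<delta>) $ l" using x by (simp add: mem_Delta)
        then show ?thesis using near[of \<delta> \<delta> l] by simp
      qed
      then show ?thesis using disj[of x] q(1)[of i] q(1)[of j] \<delta> ij by auto
    qed
    note sd = second_difference[OF bd less_imp_le[OF \<delta>] less_imp_le[OF \<delta>] ij this, unfolded V_def[symmetric]]
    show V: "V (q + axis i \<delta> + axis j \<delta>) + V q = V (q + axis i \<delta>) + V (q + axis j \<delta>)"
      by (rule sd(1))
    have "M (q + axis i \<delta> + axis j \<delta>) + M q = M (q + axis i \<delta>) + M (q + axis j \<delta>)"
      using arg_cong[OF sd(2), of "inner H"] by (simp add: M_def inner_add_right)
    moreover have "M q = V q * Lf q" "M (q + axis i \<delta>) = V (q + axis i \<delta>) * Lf (q + axis i \<delta>)"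
      "M (q + axis j \<delta>) = V (q + axis j \<delta>) * Lf (q + axis j \<delta>)"
      "M (q + axis i \<delta> + axis j \<delta>) = V (q + axis i \<delta> + axis j \<delta>) * Lf (q + axis i \<delta> + axis j \<delta>)"
      using VM[OF near, of 0 0] VM[OF near, of \<delta> 0] VM[OF near, of 0 \<delta>] VM[OF near, of \<delta> \<delta>]
      by (simp_all add: ax0)
    ultimately have M: "V (q + axis i \<delta> + axis j \<delta>) * (Lf q + \<gamma> i * \<delta> + \<gamma> j * \<delta>) + V q * Lf q =
        V (q + axis i \<delta>) * (Lf q + \<gamma> i * \<delta>) + V (q + axis j \<delta>) * (Lf q + \<gamma> j * \<delta>)"
      by (simp add: Lf)
    have alg: "x * (b - v) + y * (a - v) = 0"
      if "w + v = a + b" "w * (l + x + y) + v * l = a * (l + x) + b * (l + y)" for a b v w x y l :: real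
    proof -
      have w: "w = a + b - v" using that(1) by simp
      show ?thesis using that(2) unfolding w by (simp add: algebra_simps)
    qed
    have "\<delta> * (\<gamma> i * (V (q + axis j \<delta>) - V q) + \<gamma> j * (V (q + axis i \<delta>) - V q)) = 0"
      using alg[OF V M] by (simp add: algebra_simps)
    then show "\<gamma> i * (V (q + axis j \<delta>) - V q) + \<gamma> j * (V (q + axis i \<delta>) - V q) = 0"
      using \<delta> by simp
  qed
  let ?q = "\<kappa>' + axis i (- \<delta>)"
  have shift_back: "?q + axis i \<delta> = \<kappa>'" by (simp add: vec_eq_iff axis_entry)
  have at_q: "\<gamma> i * (V (\<kappa>' + axis j \<delta>) - V \<kappa>') + \<gamma> j * (V (\<kappa>' + axis i \<delta>) - V \<kappa>') = 0"
  proof (rule two(2))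
    show "- \<delta> - (if l = i then \<delta> else 0) \<le> \<kappa>' $ l - \<kappa> $ l" "\<kappa>' $ l - \<kappa> $ l \<le> \<delta>" for l
      using \<kappa>'[of l] \<delta> by (auto simp: abs_le_iff)
  qed
  have q: "- \<delta> - (if l = i then \<delta> else 0) \<le> ?q $ l - \<kappa> $ l" "?q $ l - \<kappa> $ l \<le> \<delta>" for l
    using \<kappa>'[of l] \<delta> by (auto simp: abs_le_iff axis_entry)
  have same: "V (\<kappa>' + axis j \<delta>) - V \<kappa>' = V (?q + axis j \<delta>) - V ?q"
    using two(1)[OF q, unfolded shift_back] by linarith
  moreover from two(2)[OF q, unfolded shift_back]
  have "\<gamma> i * (V (?q + axis j \<delta>) - V ?q) + \<gamma> j * (V \<kappa>' - V ?q) = 0" .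
  ultimately have "\<gamma> j * (V (\<kappa>' + axis i \<delta>) - V \<kappa>') = \<gamma> j * (V \<kappa>' - V ?q)"
    using at_q[unfolded same] by linarith
  moreover have "\<gamma> j \<noteq> 0"
  proof
    assume "\<gamma> j = 0"
    then have "V (\<kappa>' + axis j \<delta>) = V \<kappa>'" using at_q gi by simp
    moreover have "V \<kappa>' < V (\<kappa>' + axis j \<delta>)"
      unfolding V_def
    proof (intro volume_strict_mono s \<delta>)
      show "\<bar>(\<kappa>' + axis j \<delta>) $ l - \<kappa> $ l\<bar> \<le> 2 * \<delta>" for l
        using \<kappa>'[of l] \<delta> by (auto simp: abs_le_iff axis_entry)
    qed
    ultimately show False by simp
  qed
  ultimately show ?thesis unfolding V_def by simp
qed

section \<open>Slabs around an edge\<close>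

text \<open>The points of the polytope at which each inequality in \<open>K\<close> has slack less than \<open>\<delta>\<close>. For small
  \<open>\<delta>\<close> this is a neighbourhood, in the polytope, of the face in which the facets of \<open>K\<close> meet.\<close>

definition slab :: "('n::finite \<Rightarrow> 'a::euclidean_space) \<Rightarrow> real ^ 'n \<Rightarrow> real \<Rightarrow> 'n set \<Rightarrow> 'a set" where
  "slab \<eta> \<kappa> \<delta> K = {x \<in> Delta \<eta> \<kappa>. \<forall>k\<in>K. \<kappa> $ k - \<delta> < \<eta> k \<bullet> x}"

text \<open>Adding \<open>k\<close> to the slab amounts to a difference in the \<open>k\<close>-th support number.\<close>

lemma slab_insert:
  assumes "k \<notin> K" "\<delta> \<ge> 0"
  shows "slab \<eta> \<kappa> \<delta> (insert k K) = slab \<eta> \<kappa> \<delta> K - slab \<eta> (\<kappa> + axis k (- \<delta>)) \<delta> K"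
    and "slab \<eta> (\<kappa> + axis k (- \<delta>)) \<delta> K \<subseteq> slab \<eta> \<kappa> \<delta> K"
proof -
  have K: "(\<forall>m\<in>K. (\<kappa> + axis k (- \<delta>)) $ m - \<delta> < \<eta> m \<bullet> x) \<longleftrightarrow> (\<forall>m\<in>K. \<kappa> $ m - \<delta> < \<eta> m \<bullet> x)" for x
    using assms(1) by (intro ball_cong refl) (auto simp: axis_entry)
  have D: "x \<in> Delta \<eta> (\<kappa> + axis k (- \<delta>)) \<longleftrightarrow> x \<in> Delta \<eta> \<kappa> \<and> \<eta> k \<bullet> x \<le> \<kappa> $ k - \<delta>" for x
  proof -
    have "\<eta> l \<bullet> x \<le> (\<kappa> + axis k (- \<delta>)) $ l \<longleftrightarrow>
        \<eta> l \<bullet> x \<le> \<kappa> $ l \<and> (l = k \<longrightarrow> \<eta> k \<bullet> x \<le> \<kappa> $ k - \<delta>)" for l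
      using assms(2) by (auto simp: axis_entry)
    then show ?thesis unfolding mem_Delta by blast
  qed
  show "slab \<eta> \<kappa> \<delta> (insert k K) = slab \<eta> \<kappa> \<delta> K - slab \<eta> (\<kappa> + axis k (- \<delta>)) \<delta> K"
    unfolding slab_def K D by (auto simp: not_le)
  show "slab \<eta> (\<kappa> + axis k (- \<delta>)) \<delta> K \<subseteq> slab \<eta> \<kappa> \<delta> K"
    unfolding slab_def K D by blast
qed

lemma borel_slab: "slab \<eta> \<kappa> \<delta> K \<in> sets borel"
proof -
  have eq: "slab \<eta> \<kappa> \<delta> K = Delta \<eta> \<kappa> \<inter> {x. \<forall>k. k \<in> K \<longrightarrow> \<kappa> $ k - \<delta> < \<eta> k \<bullet> x}"
    by (auto simp: slab_def)
  show ?thesis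
    unfolding eq by (intro sets.Int borel_Delta borel_open open_slices)
qed

lemma slab_subset: "slab \<eta> \<kappa> \<delta> K \<subseteq> Delta \<eta> \<kappa>"
  by (auto simp: slab_def)

lemma measure_slab_insert:
  assumes "bounded (Delta \<eta> \<kappa>)" "k \<notin> K" "\<delta> \<ge> 0"
  shows "measure lborel (slab \<eta> \<kappa> \<delta> (insert k K)) =
    measure lborel (slab \<eta> \<kappa> \<delta> K) - measure lborel (slab \<eta> (\<kappa> + axis k (- \<delta>)) \<delta> K)"
proof -
  have "slab \<eta> \<kappa> \<delta> K \<in> fmeasurable lborel"
    using bounded_borel_finite[OF bounded_subset[OF assms(1) slab_subset] borel_slab] .
  then show ?thesis
    unfolding slab_insert(1)[OF assms(2,3)]
    by (intro measure_Diff slab_insert(2) assms) (auto simp: fmeasurable_def borel_slab)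
qed

text \<open>For \<open>K = {}\<close> this is the affinity of the volume, and every further index in \<open>K\<close> is a difference
  in another coordinate. The base point loses its freedom in the coordinates of \<open>K\<close>, since each of
  these differences uses up a step \<open>\<delta>\<close>.\<close>

lemma slab_measure_invariant:
  fixes \<eta> :: "'n::finite \<Rightarrow> 'a::euclidean_space"
  assumes bd: "\<And>q. bounded (Delta \<eta> q)" and \<delta>: "\<delta> \<ge> 0"
    and affine: "\<And>q. (\<And>l. \<bar>q $ l - \<kappa> $ l\<bar> \<le> \<delta>) \<Longrightarrow>
      measure lborel (Delta \<eta> (q + axis i \<delta>)) - measure lborel (Delta \<eta> q) =
      measure lborel (Delta \<eta> q) - measure lborel (Delta \<eta> (q + axis i (- \<delta>)))"
    and K: "i \<notin> K" and q: "\<And>l. \<bar>q $ l - \<kappa> $ l\<bar> \<le> (if l \<in> K then 0 else \<delta>)"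
  shows "measure lborel (slab \<eta> (q + axis i \<delta>) \<delta> (insert i K)) = measure lborel (slab \<eta> q \<delta> (insert i K))"
proof -
  have "finite K" by simp
  then show ?thesis using K q
  proof (induction K arbitrary: q)
    case empty
    have e: "slab \<eta> p \<delta> {} = Delta \<eta> p" for p by (simp add: slab_def)
    have shift_back: "q + axis i \<delta> + axis i (- \<delta>) = q" by (simp add: vec_eq_iff axis_entry)
    show ?case
      unfolding measure_slab_insert[OF bd empty(1) \<delta>] shift_back e using affine[of q] empty(2) by simp
  next
    case (insert k K)
    have ik: "i \<notin> K" "k \<notin> insert i K" using insert by auto
    have swap: "q + axis i \<delta> + axis k (- \<delta>) = q + axis k (- \<delta>) + axis i \<delta>"
      by (simp add: algebra_simps)
    have 1: "\<bar>q $ l - \<kappa> $ l\<bar> \<le> (if l \<in> K then 0 else \<delta>)" for l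
      using insert.prems(2)[of l] \<delta> by (auto split: if_splits)
    have 2: "\<bar>(q + axis k (- \<delta>)) $ l - \<kappa> $ l\<bar> \<le> (if l \<in> K then 0 else \<delta>)" for l
      using insert.prems(2)[of l] \<delta> insert.hyps(2) by (auto simp: axis_entry split: if_splits)
    show ?case
      unfolding insert_commute[of i k] measure_slab_insert[OF bd ik(2) \<delta>] swap
      using insert.IH[OF ik(1) 1] insert.IH[OF ik(1) 2] by simp
  qed
qed

text \<open>The edge cut out by \<open>i\<close> and \<open>K\<close> has one end on the facet \<open>k\<close> and the other end \<open>u'\<close> on \<open>b\<close>. One of
  \<open>a\<close> and \<open>a'\<close> is zero and the other is \<open>\<delta>\<close>, so that upward and downward moves of the facet \<open>i\<close> are
  treated together. If the translation by \<open>(a' - a) w\<close> moves points away from the hyperplane of \<open>b\<close>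
  into the polytope, then it maps the slab at level \<open>a\<close> into the one at level \<open>a'\<close>, and the image
  misses an open set near \<open>u'\<close>.\<close>

lemma slab_translate:
  fixes \<eta> :: "'n::finite \<Rightarrow> 'a::euclidean_space" and K :: "'n set"
  assumes s: "simple_polytope \<eta> \<kappa>"
    and near: "\<And>x J. (\<And>l. \<eta> l \<bullet> x \<le> \<kappa> $ l + \<epsilon>) \<Longrightarrow> (\<And>l. l \<in> J \<Longrightarrow> \<kappa> $ l - \<epsilon> \<le> \<eta> l \<bullet> x) \<Longrightarrow>
       \<exists>v. v extreme_point_of Delta \<eta> \<kappa> \<and> J \<subseteq> active \<eta> \<kappa> v"
    and \<delta>: "\<delta> > 0" "\<delta> \<le> \<epsilon>" "\<And>l. \<delta> * \<bar>\<eta> l \<bullet> w\<bar> \<le> \<epsilon>"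
    and u': "u' extreme_point_of Delta \<eta> \<kappa>" "active \<eta> \<kappa> u' = insert b (insert i K)"
    and out: "i \<notin> K" "b \<notin> insert i K"
    and w: "\<eta> i \<bullet> w = 1" "\<And>l. l \<in> insert k K \<Longrightarrow> \<eta> l \<bullet> w = 0"
    and only: "\<And>p. p extreme_point_of Delta \<eta> \<kappa> \<Longrightarrow> insert i K \<subseteq> active \<eta> \<kappa> p \<Longrightarrow>
      active \<eta> \<kappa> p \<subseteq> insert b (insert k (insert i K))"
    and a: "(a = 0 \<and> a' = \<delta>) \<or> (a = \<delta> \<and> a' = 0)" and neg: "(a' - a) * (\<eta> b \<bullet> w) < 0"
  shows "measure lborel (slab \<eta> (\<kappa> + axis i a) \<delta> (insert i K)) <
    measure lborel (slab \<eta> (\<kappa> + axis i a') \<delta> (insert i K))"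
proof -
  let ?A = "slab \<eta> (\<kappa> + axis i a) \<delta> (insert i K)" and ?B = "slab \<eta> (\<kappa> + axis i a') \<delta> (insert i K)"
  define c where "c = a' - a"
  define T where "T = (\<lambda>x. c *\<^sub>R w + x) ` ?A"
  have abs_c: "\<bar>c\<bar> = \<delta>" using a \<delta>(1) by (auto simp: c_def)
  have bd: "bounded (Delta \<eta> q)" for q using bounded_Delta_all[OF s] .
  have memA: "(\<forall>l. \<eta> l \<bullet> x \<le> \<kappa> $ l + (if l = i then a else 0)) \<and>
      (\<forall>m\<in>insert i K. \<kappa> $ m + (if m = i then a else 0) - \<delta> < \<eta> m \<bullet> x)" if "x \<in> ?A" for x
    using that unfolding slab_def mem_Delta vector_add_component axis_entry by blast
  have memB: "x \<in> ?B" if "\<And>l. \<eta> l \<bullet> x \<le> \<kappa> $ l + (if l = i then a' else 0)"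
      "\<And>m. m \<in> insert i K \<Longrightarrow> \<kappa> $ m + (if m = i then a' else 0) - \<delta> < \<eta> m \<bullet> x" for x
    using that unfolding slab_def mem_Delta vector_add_component axis_entry by blast
  have TB: "T \<subseteq> ?B"
  proof
    fix y assume "y \<in> T"
    then obtain x where x: "x \<in> ?A" and y: "y = c *\<^sub>R w + x" by (auto simp: T_def)
    have ey: "\<eta> l \<bullet> y = \<eta> l \<bullet> x + c * (\<eta> l \<bullet> w)" for l by (simp add: y inner_add_right)
    note xA = memA[OF x]
    have le: "\<eta> l \<bullet> x \<le> \<kappa> $ l + (if l = i then a else 0)" for l using xA by blast
    have gt: "\<kappa> $ m + (if m = i then a else 0) - \<delta> < \<eta> m \<bullet> x" if "m \<in> insert i K" for m
      using xA that by blast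
    show "y \<in> ?B"
    proof (rule memB)
      fix l
      consider "l = i" | "l \<in> insert k K" "l \<noteq> i" | "l = b" | "l \<notin> insert b (insert k (insert i K))" by blast
      then show "\<eta> l \<bullet> y \<le> \<kappa> $ l + (if l = i then a' else 0)"
      proof cases
        case 1
        then show ?thesis using le[of i] w(1) by (simp add: ey c_def)
      next
        case 2
        then show ?thesis using le[of l] w(2)[OF 2(1)] by (simp add: ey)
      next
        case 3
        then show ?thesis using le[of b] neg out by (simp add: ey c_def)
      next
        case 4
        then have li: "l \<noteq> i" by blast
        show ?thesis
        proof (rule ccontr)
          assume "\<not> ?thesis"
          then have "\<kappa> $ l < \<eta> l \<bullet> x + c * (\<eta> l \<bullet> w)" using li by (simp add: ey)
          moreover have "c * (\<eta> l \<bullet> w) \<le> \<delta> * \<bar>\<eta> l \<bullet> w\<bar>" by (metis abs_c abs_ge_self abs_mult)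
          ultimately have xl: "\<kappa> $ l - \<epsilon> \<le> \<eta> l \<bullet> x" using \<delta>(3)[of l] by linarith
          \<comment> \<open>Otherwise the facet \<open>l\<close> would contain an end of the edge.\<close>
          have "\<exists>v. v extreme_point_of Delta \<eta> \<kappa> \<and> insert l (insert i K) \<subseteq> active \<eta> \<kappa> v"
          proof (rule near)
            show "\<eta> m \<bullet> x \<le> \<kappa> $ m + \<epsilon>" for m
              using le[of m] a \<delta>(1,2) by (auto split: if_splits)
            show "\<kappa> $ m - \<epsilon> \<le> \<eta> m \<bullet> x" if "m \<in> insert l (insert i K)" for m
              using that xl gt[of m] a \<delta>(1,2) by (auto split: if_splits)
          qed
          then show False using only 4 by blast
        qed
      qed
    next
      fix m assume m: "m \<in> insert i K"
      show "\<kappa> $ m + (if m = i then a' else 0) - \<delta> < \<eta> m \<bullet> y"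
        using gt[OF m] m w out(1) by (auto simp: ey c_def)
    qed
  qed
  have T_borel: "T \<in> sets borel" and T_measure: "measure lborel T = measure lborel ?A"
  proof -
    have *: "T = (\<lambda>y. y - c *\<^sub>R w) -` ?A \<inter> space borel" by (force simp: T_def)
    show "T \<in> sets borel" unfolding * by (intro measurable_sets[OF _ borel_slab]) simp
    then show "measure lborel T = measure lborel ?A"
      using measure_translation[of "c *\<^sub>R w" ?A] borel_slab[of \<eta> "\<kappa> + axis i a" \<delta> "insert i K"]
      by (simp add: T_def)
  qed
  \<comment> \<open>From \<open>u'\<close>, move into the polytope, but towards level \<open>a'\<close> of the facet \<open>i\<close>, to reach the gap.\<close>
  define \<zeta> where "\<zeta> = (if a' = 0 then - 1 else 1 :: real)"
  obtain z where z: "\<And>l. l \<in> active \<eta> \<kappa> u' \<Longrightarrow> \<eta> l \<bullet> z = (if l = i then \<zeta> else - 1)"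
    using simple_dual_vector[OF s u'(1), where g = "\<lambda>l. if l = i then \<zeta> else - 1"] by blast
  have u'_eq: "\<eta> l \<bullet> u' = \<kappa> $ l" if "l \<in> insert b (insert i K)" for l
    using that u'(2) by (auto simp: active_def)
  define lo where "lo m = (if m = b then \<kappa> $ b + c * (\<eta> b \<bullet> w) else \<kappa> $ m + (if m = i then a' else 0) - \<delta>)" for m
  let ?U = "{x. \<forall>l. True \<longrightarrow> \<eta> l \<bullet> x < \<kappa> $ l + (if l = i then a' else 0)} \<inter>
    {x. \<forall>m. m \<in> insert b (insert i K) \<longrightarrow> lo m < \<eta> m \<bullet> x}"
  have "\<forall>\<^sub>F t in at_right 0. \<forall>l. l \<notin> {i} \<longrightarrow> \<eta> l \<bullet> (u' + t *\<^sub>R z) < \<kappa> $ l"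
    using z by (intro vertex_move_eventually extreme_point_in[OF u'(1)]) auto
  moreover have "\<forall>\<^sub>F t in at_right 0. \<forall>m. m \<in> insert b K \<longrightarrow> (- \<eta> m) \<bullet> (u' + t *\<^sub>R z) < - lo m"
  proof (rule eventually_all_finite)
    fix m
    show "\<forall>\<^sub>F t in at_right 0. m \<in> insert b K \<longrightarrow> (- \<eta> m) \<bullet> (u' + t *\<^sub>R z) < - lo m"
    proof (cases "m \<in> insert b K")
      case True
      then have "(- \<eta> m) \<bullet> u' < - lo m"
        using u'_eq[of m] neg \<delta>(1) out by (auto simp: lo_def c_def)
      then show ?thesis by (rule eventually_mono[OF eventually_slack[where z = z]]) auto
    qed auto
  qed
  ultimately have "\<forall>\<^sub>F t in at_right 0. (\<forall>l. l \<notin> {i} \<longrightarrow> \<eta> l \<bullet> (u' + t *\<^sub>R z) < \<kappa> $ l) \<and>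
      (\<forall>m. m \<in> insert b K \<longrightarrow> (- \<eta> m) \<bullet> (u' + t *\<^sub>R z) < - lo m) \<and> t \<in> {0<..<\<delta>}"
    using \<delta>(1) by (intro eventually_conj eventually_at_right_real)
  then obtain t where t: "\<And>l. l \<noteq> i \<Longrightarrow> \<eta> l \<bullet> (u' + t *\<^sub>R z) < \<kappa> $ l"
      "\<And>m. m \<in> insert b K \<Longrightarrow> (- \<eta> m) \<bullet> (u' + t *\<^sub>R z) < - lo m" "0 < t" "t < \<delta>"
    using eventually_happens'[OF trivial_limit_at_right_real] by fastforce
  have eti: "\<eta> i \<bullet> (u' + t *\<^sub>R z) = \<kappa> $ i + t * \<zeta>"
    using u'_eq[of i] z[of i] u'(2) by (simp add: inner_add_right)
  have "\<eta> l \<bullet> (u' + t *\<^sub>R z) < \<kappa> $ l + (if l = i then a' else 0)" for l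
    using t(1)[of l] eti t(3,4) a by (cases "l = i") (auto simp: \<zeta>_def)
  moreover have "lo m < \<eta> m \<bullet> (u' + t *\<^sub>R z)" if "m \<in> insert b (insert i K)" for m
  proof (cases "m = i")
    case True
    then show ?thesis using eti t(3,4) a out \<delta>(1) by (auto simp: \<zeta>_def lo_def)
  next
    case False
    then show ?thesis using t(2)[of m] that by simp
  qed
  ultimately have "u' + t *\<^sub>R z \<in> ?U" by blast
  then have Une: "?U \<noteq> {}" by blast
  have "?U \<subseteq> ?B - T"
  proof
    fix x assume x: "x \<in> ?U"
    have x1: "\<eta> l \<bullet> x < \<kappa> $ l + (if l = i then a' else 0)" for l using x by blast
    have x2: "lo m < \<eta> m \<bullet> x" if "m \<in> insert b (insert i K)" for m using x that by blast
    have "x \<in> ?B"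
    proof (rule memB)
      show "\<eta> l \<bullet> x \<le> \<kappa> $ l + (if l = i then a' else 0)" for l using x1[of l] by simp
      show "\<kappa> $ m + (if m = i then a' else 0) - \<delta> < \<eta> m \<bullet> x" if "m \<in> insert i K" for m
      proof -
        have "m \<noteq> b" using that out by blast
        then show ?thesis using x2[of m] that by (simp add: lo_def)
      qed
    qed
    moreover have "x \<notin> T"
    proof
      assume "x \<in> T"
      then obtain x0 where x0: "x0 \<in> ?A" "x = c *\<^sub>R w + x0" by (auto simp: T_def)
      have "\<eta> b \<bullet> x0 \<le> \<kappa> $ b" using memA[OF x0(1)] out by (auto dest!: spec[of _ b])
      then show False using x2[of b] by (simp add: x0(2) inner_add_right lo_def)
    qed
    ultimately show "x \<in> ?B - T" by blast
  qed
  moreover have "open ?U" by (intro open_Int open_slices)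
  ultimately have "measure lborel T < measure lborel ?B"
    using Une by (intro measure_less_open_gap[OF T_borel borel_slab bounded_subset[OF bd slab_subset] TB])
  then show ?thesis by (simp add: T_measure)
qed

lemma edge_direction_constant:
  fixes \<eta> :: "'n::finite \<Rightarrow> 'a::euclidean_space" and K :: "'n set"
  assumes s: "simple_polytope \<eta> \<kappa>"
    and near: "\<And>x J. (\<And>l. \<eta> l \<bullet> x \<le> \<kappa> $ l + \<epsilon>) \<Longrightarrow> (\<And>l. l \<in> J \<Longrightarrow> \<kappa> $ l - \<epsilon> \<le> \<eta> l \<bullet> x) \<Longrightarrow>
       \<exists>v. v extreme_point_of Delta \<eta> \<kappa> \<and> J \<subseteq> active \<eta> \<kappa> v"
    and \<delta>: "\<delta> > 0" "\<delta> \<le> \<epsilon>" "\<And>l. \<delta> * \<bar>\<eta> l \<bullet> w\<bar> \<le> \<epsilon>"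
    and u': "u' extreme_point_of Delta \<eta> \<kappa>" "active \<eta> \<kappa> u' = insert b (insert i K)"
    and out: "i \<notin> K" "b \<notin> insert i K"
    and w: "\<eta> i \<bullet> w = 1" "\<And>l. l \<in> insert k K \<Longrightarrow> \<eta> l \<bullet> w = 0"
    and only: "\<And>p. p extreme_point_of Delta \<eta> \<kappa> \<Longrightarrow> insert i K \<subseteq> active \<eta> \<kappa> p \<Longrightarrow>
      active \<eta> \<kappa> p \<subseteq> insert b (insert k (insert i K))"
    and eq: "measure lborel (slab \<eta> (\<kappa> + axis i \<delta>) \<delta> (insert i K)) =
      measure lborel (slab \<eta> \<kappa> \<delta> (insert i K))"
  shows "\<eta> b \<bullet> w = 0"
proof -
  have ax0: "axis i 0 = (0 :: real ^ 'n)" by (simp add: vec_eq_iff axis_entry)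
  have tr: "measure lborel (slab \<eta> (\<kappa> + axis i a) \<delta> (insert i K)) <
      measure lborel (slab \<eta> (\<kappa> + axis i a') \<delta> (insert i K))"
    if "(a = 0 \<and> a' = \<delta>) \<or> (a = \<delta> \<and> a' = 0)" "(a' - a) * (\<eta> b \<bullet> w) < 0" for a a'
    by (rule slab_translate[where u' = u' and b = b and k = k and w = w and \<epsilon> = \<epsilon>]) fact+
  have "\<not> \<eta> b \<bullet> w < 0"
  proof
    assume "\<eta> b \<bullet> w < 0"
    then have "(\<delta> - 0) * (\<eta> b \<bullet> w) < 0" using \<delta>(1) by (simp add: mult_pos_neg)
    from tr[OF _ this] show False using eq by (simp add: ax0)
  qed
  moreover have "\<not> \<eta> b \<bullet> w > 0"
  proof
    assume "\<eta> b \<bullet> w > 0"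
    then have "(0 - \<delta>) * (\<eta> b \<bullet> w) < 0" using \<delta>(1) by simp
    from tr[OF _ this] show False using eq by (simp add: ax0)
  qed
  ultimately show ?thesis by linarith
qed

section \<open>Asymmetric facets are pervasive or flat\<close>

theorem proposition2p11:
  fixes \<eta> :: "'n::finite \<Rightarrow> 'a::euclidean_space" and \<kappa> :: "real ^ 'n" and H :: 'a
  assumes "simple_polytope \<eta> \<kappa>"
    and "mass_linear \<eta> \<kappa> H"
  shows "\<forall>i. asymmetric_facet \<eta> \<kappa> H i \<longrightarrow> pervasive_facet \<eta> \<kappa> i \<or> flat_facet \<eta> \<kappa> i"
proof (unfold disj_imp, intro allI impI)
  fix i assume asym: "asymmetric_facet \<eta> \<kappa> H i" and "\<not> pervasive_facet \<eta> \<kappa> i"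
  note s = assms(1)
  obtain j where ij: "i \<noteq> j" and fij: "facet \<eta> \<kappa> i \<inter> facet \<eta> \<kappa> j = {}"
    using \<open>\<not> pervasive_facet \<eta> \<kappa> i\<close> unfolding pervasive_facet_def by metis
  obtain \<gamma> C where L: "\<And>q. q \<in> chamber \<eta> \<kappa> \<Longrightarrow>
      H \<bullet> center_of_mass (Delta \<eta> q) = (\<Sum>i\<in>UNIV. \<gamma> i * q $ i) + C"
    using assms(2) unfolding mass_linear_def by blast
  have gi: "\<gamma> i \<noteq> 0"
  proof
    assume "\<gamma> i = 0"
    have "symmetric_facet \<eta> \<kappa> H i"
      unfolding symmetric_facet_def
    proof (intro ballI impI)
      fix p q assume pq: "p \<in> chamber \<eta> \<kappa>" "q \<in> chamber \<eta> \<kappa>" "\<forall>j. j \<noteq> i \<longrightarrow> p $ j = q $ j"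
      have "(\<Sum>i\<in>UNIV. \<gamma> i * p $ i) = (\<Sum>i\<in>UNIV. \<gamma> i * q $ i)"
      proof (rule sum.cong[OF refl])
        fix l show "\<gamma> l * p $ l = \<gamma> l * q $ l"
          using pq(3) \<open>\<gamma> i = 0\<close> by (cases "l = i") auto
      qed
      then show "H \<bullet> center_of_mass (Delta \<eta> p) = H \<bullet> center_of_mass (Delta \<eta> q)"
        using L pq by simp
    qed
    then show False using asym by simp
  qed
  obtain \<epsilon> where \<epsilon>: "\<epsilon> > 0"
    and near: "\<And>x J. (\<And>l. \<eta> l \<bullet> x \<le> \<kappa> $ l + \<epsilon>) \<Longrightarrow> (\<And>l. l \<in> J \<Longrightarrow> \<kappa> $ l - \<epsilon> \<le> \<eta> l \<bullet> x) \<Longrightarrow>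
       \<exists>v. v extreme_point_of Delta \<eta> \<kappa> \<and> J \<subseteq> active \<eta> \<kappa> v"
    using nearly_active_near_vertex[OF s] by blast
  obtain \<epsilon>' where \<epsilon>': "\<epsilon>' > 0"
    and box: "\<And>q. (\<And>l. \<bar>q $ l - \<kappa> $ l\<bar> \<le> \<epsilon>') \<Longrightarrow> simple_polytope \<eta> q"
    using simple_polytope_open[OF s] by blast
  have bd: "bounded (Delta \<eta> q)" for q using bounded_Delta_all[OF s] .
  obtain v where v: "v extreme_point_of Delta \<eta> \<kappa>" "i \<in> active \<eta> \<kappa> v"
    using simple_facet_vertex[OF s, of i] by blast
  obtain w where w: "\<And>l. l \<in> active \<eta> \<kappa> v \<Longrightarrow> \<eta> l \<bullet> w = (if l = i then 1 else 0)"
    using simple_dual_vector[OF s v(1), where g = "\<lambda>l. if l = i then 1 else 0"] by blast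
  have wi: "\<eta> i \<bullet> w = 1" using w[OF v(2)] by simp
  \<comment> \<open>The step \<open>\<delta>\<close> keeps the support numbers in the chamber, and \<open>\<delta> * c\<close> bounds the change of every
    \<open>\<eta> l\<close> under a translation by \<open>\<delta> w\<close>.\<close>
  define m where "m = min \<epsilon> \<epsilon>'"
  define c where "c = 1 + (\<Sum>l\<in>UNIV. \<bar>\<eta> l \<bullet> w\<bar>)"
  define \<delta> where "\<delta> = m / (2 * c)"
  have m: "m > 0" "m \<le> \<epsilon>" "m \<le> \<epsilon>'" using \<epsilon> \<epsilon>' by (auto simp: m_def)
  have c1: "c \<ge> 1" by (simp add: c_def sum_nonneg)
  have wc: "\<bar>\<eta> l \<bullet> w\<bar> \<le> c" for l
    using member_le_sum[of l UNIV "\<lambda>l. \<bar>\<eta> l \<bullet> w\<bar>"] by (simp add: c_def)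
  have \<delta>: "\<delta> > 0" using m c1 by (simp add: \<delta>_def)
  have \<delta>c: "2 * (\<delta> * c) = m" using c1 by (simp add: \<delta>_def)
  have "\<delta> * 1 \<le> \<delta> * c" using \<delta> c1 by (intro mult_left_mono) auto
  then have \<delta>m: "2 * \<delta> \<le> m" using \<delta>c by linarith
  have \<delta>w: "\<delta> * \<bar>\<eta> l \<bullet> w\<bar> \<le> \<epsilon>" for l
  proof -
    have "\<delta> * \<bar>\<eta> l \<bullet> w\<bar> \<le> \<delta> * c" using \<delta> wc by (intro mult_left_mono) auto
    then show ?thesis using \<delta>c m by linarith
  qed
  have affine: "measure lborel (Delta \<eta> (q + axis i \<delta>)) - measure lborel (Delta \<eta> q) =
      measure lborel (Delta \<eta> q) - measure lborel (Delta \<eta> (q + axis i (- \<delta>)))"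
    if q: "\<And>l. \<bar>q $ l - \<kappa> $ l\<bar> \<le> \<delta>" for q
  proof (rule volume_affine_in_asymmetric_direction
      [where \<kappa> = \<kappa> and \<gamma> = \<gamma> and H = H and C = C and j = j, OF _ _ _ ij gi \<delta> q])
    fix p :: "real ^ 'n" assume "\<And>l. \<bar>p $ l - \<kappa> $ l\<bar> \<le> 2 * \<delta>"
    then have p: "\<And>l. \<bar>p $ l - \<kappa> $ l\<bar> \<le> \<epsilon>'" using \<delta>m m(3) by (meson order_trans)
    show "simple_polytope \<eta> p" using box[OF p] .
    show "H \<bullet> center_of_mass (Delta \<eta> p) = (\<Sum>i\<in>UNIV. \<gamma> i * p $ i) + C"
      by (rule L[OF chamber_contains_box[where \<epsilon> = \<epsilon>']]) (use box \<epsilon>' p in auto)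
  next
    fix x assume x: "\<And>l. \<eta> l \<bullet> x \<le> \<kappa> $ l + 2 * \<delta>"
    show "\<eta> i \<bullet> x < \<kappa> $ i - 2 * \<delta> \<or> \<eta> j \<bullet> x < \<kappa> $ j - 2 * \<delta>"
    proof (rule ccontr)
      assume n: "\<not> ?thesis"
      have "\<exists>v. v extreme_point_of Delta \<eta> \<kappa> \<and> {i, j} \<subseteq> active \<eta> \<kappa> v"
      proof (rule near)
        show "\<eta> l \<bullet> x \<le> \<kappa> $ l + \<epsilon>" for l using x[of l] \<delta>m m(2) by linarith
        show "\<kappa> $ l - \<epsilon> \<le> \<eta> l \<bullet> x" if "l \<in> {i, j}" for l using that n \<delta>m m(2) by auto
      qed
      then obtain v where "v extreme_point_of Delta \<eta> \<kappa>" "{i, j} \<subseteq> active \<eta> \<kappa> v" by blast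
      then have "v \<in> facet \<eta> \<kappa> i \<inter> facet \<eta> \<kappa> j"
        using extreme_point_in by (auto simp: mem_facet)
      then show False using fij by blast
    qed
  qed
  have slab_eq: "measure lborel (slab \<eta> (\<kappa> + axis i \<delta>) \<delta> (insert i K)) =
      measure lborel (slab \<eta> \<kappa> \<delta> (insert i K))" if "i \<notin> K" for K
  proof (rule slab_measure_invariant[where \<kappa> = \<kappa>])
    show "measure lborel (Delta \<eta> (q + axis i \<delta>)) - measure lborel (Delta \<eta> q) =
        measure lborel (Delta \<eta> q) - measure lborel (Delta \<eta> (q + axis i (- \<delta>)))"
      if "\<And>l. \<bar>q $ l - \<kappa> $ l\<bar> \<le> \<delta>" for q by (rule affine[OF that])
  qed (use bd \<delta> that in auto)
  define Q where "Q u \<longleftrightarrow> (\<forall>l\<in>active \<eta> \<kappa> u - {i}. \<eta> l \<bullet> w = 0)" for u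
  have walk: "Q u" if u: "u extreme_point_of Delta \<eta> \<kappa>" "i \<in> active \<eta> \<kappa> u" for u
  proof (rule facet_vertex_walk[OF s v _ u])
    show "Q v" using w by (simp add: Q_def)
  next
    fix p p' k b
    assume p: "Q p" "p extreme_point_of Delta \<eta> \<kappa>" "p' extreme_point_of Delta \<eta> \<kappa>"
      "i \<in> active \<eta> \<kappa> p" "k \<in> active \<eta> \<kappa> p" "k \<noteq> i" "b \<notin> active \<eta> \<kappa> p"
      "active \<eta> \<kappa> p' = insert b (active \<eta> \<kappa> p - {k})"
      and only: "\<And>x. x extreme_point_of Delta \<eta> \<kappa> \<Longrightarrow> active \<eta> \<kappa> p - {k} \<subseteq> active \<eta> \<kappa> x \<Longrightarrow> x = p \<or> x = p'"
    define K where "K = active \<eta> \<kappa> p - {k, i}"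
    have iK: "active \<eta> \<kappa> p - {k} = insert i K" using p by (auto simp: K_def)
    have "\<eta> b \<bullet> w = 0"
    proof (rule edge_direction_constant[where \<kappa> = \<kappa> and \<epsilon> = \<epsilon> and u' = p' and K = K and k = k])
      show "\<exists>v. v extreme_point_of Delta \<eta> \<kappa> \<and> J \<subseteq> active \<eta> \<kappa> v"
        if "\<And>l. \<eta> l \<bullet> x \<le> \<kappa> $ l + \<epsilon>" "\<And>l. l \<in> J \<Longrightarrow> \<kappa> $ l - \<epsilon> \<le> \<eta> l \<bullet> x" for x J
        by (rule near[OF that])
      show "\<delta> \<le> \<epsilon>" using \<delta>m m(2) \<delta> by linarith
      show "active \<eta> \<kappa> p' = insert b (insert i K)" using p(8) iK by simp
      show "i \<notin> K" "b \<notin> insert i K" using p by (auto simp: K_def)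
      show "\<eta> i \<bullet> w = 1" by (rule wi)
      show "\<eta> l \<bullet> w = 0" if "l \<in> insert k K" for l
        using that p(1,5,6) by (auto simp: Q_def K_def)
      show "active \<eta> \<kappa> x \<subseteq> insert b (insert k (insert i K))"
        if "x extreme_point_of Delta \<eta> \<kappa>" "insert i K \<subseteq> active \<eta> \<kappa> x" for x
        using only[of x] that p(8) unfolding iK by (auto simp: K_def)
      show "measure lborel (slab \<eta> (\<kappa> + axis i \<delta>) \<delta> (insert i K)) =
          measure lborel (slab \<eta> \<kappa> \<delta> (insert i K))"
        by (rule slab_eq) (simp add: K_def)
    qed (fact s \<delta> \<delta>w p(3))+
    then show "Q p'" using p(1) by (auto simp: Q_def p(8))
  qed
  show "flat_facet \<eta> \<kappa> i"
    unfolding flat_facet_def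
  proof (intro exI conjI allI impI)
    have "w \<noteq> 0" using wi by auto
    then have "dim {x. w \<bullet> x = 0} = DIM('a) - 1" by (rule dim_hyperplane)
    then show "dim {x. w \<bullet> x = 0} + 1 = DIM('a)" using DIM_positive[where 'a = 'a] by simp
    show "subspace {x. w \<bullet> x = 0}" by (rule subspace_hyperplane)
    fix l assume l: "l \<noteq> i \<and> facet \<eta> \<kappa> l \<inter> facet \<eta> \<kappa> i \<noteq> {}"
    then obtain x where "x \<in> facet \<eta> \<kappa> l \<inter> facet \<eta> \<kappa> i" by blast
    then have "x \<in> Delta \<eta> \<kappa>" "{l, i} \<subseteq> active \<eta> \<kappa> x" by (auto simp: mem_facet)
    then obtain u where u: "u extreme_point_of Delta \<eta> \<kappa>" "{l, i} \<subseteq> active \<eta> \<kappa> u"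
      using face_has_vertex[OF bd] by metis
    then have "Q u" using walk by blast
    then show "\<eta> l \<in> {x. w \<bullet> x = 0}" using l u(2) by (auto simp: Q_def inner_commute)
  qed
qed

end
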